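(* Let $n\ge 2$ be an integer. Then $\mathrm{Div}(n)$ is homotopy equivalent to a bouquet of spheres with exactly one $j$-sphere for every collection of $j+1$ distinct proper divisors of $n$, not including $1$, which sum to $n-1$. Consequently: (1) if $n$ is deficient, then $\mathrm{Div}(n)$ is contractible; (2) $n$ is perfect if and only if $\mathrm{Div}(n)$ is homotopy equivalent to a sphere of dimension $\tau(n)-3$, where $\tau(n)$ is the number of positive integer divisors of $n$.
   Context: For an integer $n\ge2$, a proper divisor of $n$ is a positive integer divisor of $n$ different from $n$. $\mathrm{Div}(n)$ is the simplicial complex whose faces are the nonempty sets of distinct proper divisors of $n$ whose sum is less than $n$; a set of $j+1$ divisors is a $j$-dimensional face. An integer $n\ge2$ is deficient if the sum of its proper divisors is less than $n$, and perfect if that sum equals $n$. A bouquet of spheres is a wedge of a (possibly empty) collection of spheres, not necessarily of the same dimension, with $0$-spheres allowed; the empty bouquet is a point. The sphere of dimension $-1$ is the empty space. *)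

theory Defs
  imports "HOL-Analysis.Analysis" "HOL-Homology.Homology"
begin

section \<open>Divisors\<close>

definition proper_divisors :: "nat \<Rightarrow> nat set" where
  "proper_divisors n = {d. 0 < d \<and> d dvd n \<and> d \<noteq> n}"

definition divisor_count :: "nat \<Rightarrow> nat" where
  "divisor_count n = card {d. 0 < d \<and> d dvd n}"

definition deficient :: "nat \<Rightarrow> bool" where
  "deficient n \<longleftrightarrow> 2 \<le> n \<and> \<Sum>(proper_divisors n) < n"

definition perfect :: "nat \<Rightarrow> bool" where
  "perfect n \<longleftrightarrow> 2 \<le> n \<and> \<Sum>(proper_divisors n) = n"

lemma finite_proper_divisors:
  assumes "0 < n"
  shows "finite (proper_divisors n)"
  by (rule finite_subset[of _ "{..n}"])
     (use assms in \<open>auto simp: proper_divisors_def dest: dvd_imp_le\<close>)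


section \<open>Simplicial complexes\<close>

definition simplicial_complex_on :: "'a set \<Rightarrow> 'a set set \<Rightarrow> bool" where
  "simplicial_complex_on V K \<longleftrightarrow>
     (\<forall>F\<in>K. F \<noteq> {} \<and> finite F \<and> F \<subseteq> V) \<and>
     (\<forall>F\<in>K. \<forall>G. G \<noteq> {} \<and> G \<subseteq> F \<longrightarrow> G \<in> K)"

text \<open>
  Points are given by barycentric coordinates: nonnegative functions on the vertices whose
  support is a face and whose values add up to 1. They carry the topology of pointwise
  convergence. For a finite complex, the only case used here, this is the usual (weak) topology;
  for infinite complexes it would not be.
\<close>

definition geometric_realization :: "'a set set \<Rightarrow> ('a \<Rightarrow> real) topology" where
  "geometric_realization K =
     subtopology (powertop_real UNIV)
       {x. (\<forall>v. 0 \<le> x v) \<and> {v. x v \<noteq> 0} \<in> K \<and> (\<Sum>v | x v \<noteq> 0. x v) = 1}"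

definition Div_complex :: "nat \<Rightarrow> nat set set" where
  "Div_complex n = {F. F \<noteq> {} \<and> F \<subseteq> proper_divisors n \<and> \<Sum>F < n}"

lemma simplicial_complex_Div_complex:
  assumes "0 < n"
  shows "simplicial_complex_on (proper_divisors n) (Div_complex n)"
  unfolding simplicial_complex_on_def
proof (intro conjI ballI allI impI)
  fix F assume F: "F \<in> Div_complex n"
  then show "F \<noteq> {}" "F \<subseteq> proper_divisors n"
    by (auto simp: Div_complex_def)
  then show fin: "finite F"
    using finite_proper_divisors[OF assms] finite_subset by blast
  fix G assume G: "G \<noteq> {} \<and> G \<subseteq> F"
  then have "\<Sum>G \<le> \<Sum>F"
    using fin by (intro sum_mono2) auto
  with F G show "G \<in> Div_complex n"
    by (auto simp: Div_complex_def)
qed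

lemma finite_Div_complex:
  assumes "0 < n"
  shows "finite (Div_complex n)"
  by (rule finite_subset[of _ "Pow (proper_divisors n)"])
     (auto simp: Div_complex_def finite_proper_divisors[OF assms])


section \<open>Wedges and bouquets of spheres\<close>

text \<open>
  The wedge of the pointed spaces \<open>(X i, p i)\<close>, \<open>i \<in> I\<close>. The common base point is \<open>None\<close>, and a
  point \<open>x \<noteq> p i\<close> of \<open>X i\<close> becomes \<open>Some (i, x)\<close>. The topology is the final one with respect
  to the inclusions of the \<open>X i\<close>, i.e. the quotient topology of the disjoint union. For empty
  \<open>I\<close> the wedge is the single point \<open>None\<close>.
\<close>

definition wedge_incl :: "('i \<Rightarrow> 'a) \<Rightarrow> 'i \<Rightarrow> 'a \<Rightarrow> ('i \<times> 'a) option" where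
  "wedge_incl p i x = (if x = p i then None else Some (i, x))"

definition wedge_carrier ::
    "'i set \<Rightarrow> ('i \<Rightarrow> 'a topology) \<Rightarrow> ('i \<Rightarrow> 'a) \<Rightarrow> ('i \<times> 'a) option set" where
  "wedge_carrier I X p = insert None (\<Union>i\<in>I. wedge_incl p i ` topspace (X i))"

definition wedge ::
    "'i set \<Rightarrow> ('i \<Rightarrow> 'a topology) \<Rightarrow> ('i \<Rightarrow> 'a) \<Rightarrow> ('i \<times> 'a) option topology" where
  "wedge I X p = topology (\<lambda>U. U \<subseteq> wedge_carrier I X p \<and>
     (\<forall>i\<in>I. openin (X i) {x \<in> topspace (X i). wedge_incl p i x \<in> U}))"

lemma openin_wedge:
  "openin (wedge I X p) U \<longleftrightarrow> U \<subseteq> wedge_carrier I X p \<and>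
     (\<forall>i\<in>I. openin (X i) {x \<in> topspace (X i). wedge_incl p i x \<in> U})"
proof -
  let ?P = "\<lambda>U. U \<subseteq> wedge_carrier I X p \<and>
     (\<forall>i\<in>I. openin (X i) {x \<in> topspace (X i). wedge_incl p i x \<in> U})"
  have "istopology ?P"
    unfolding istopology_def
  proof (intro conjI allI impI)
    fix S T assume S: "?P S" and T: "?P T"
    have "openin (X i) {x \<in> topspace (X i). wedge_incl p i x \<in> S \<inter> T}" if "i \<in> I" for i
    proof -
      have "{x \<in> topspace (X i). wedge_incl p i x \<in> S \<inter> T} =
        {x \<in> topspace (X i). wedge_incl p i x \<in> S} \<inter> {x \<in> topspace (X i). wedge_incl p i x \<in> T}"
        by auto
      then show ?thesis
        using S T that by (metis (no_types, lifting) openin_Int)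
    qed
    with S T show "S \<inter> T \<subseteq> wedge_carrier I X p"
      "\<forall>i\<in>I. openin (X i) {x \<in> topspace (X i). wedge_incl p i x \<in> S \<inter> T}"
      by auto
  next
    fix \<K> assume K: "\<forall>S\<in>\<K>. ?P S"
    have "openin (X i) {x \<in> topspace (X i). wedge_incl p i x \<in> \<Union>\<K>}" if "i \<in> I" for i
    proof -
      have "{x \<in> topspace (X i). wedge_incl p i x \<in> \<Union>\<K>} =
        (\<Union>S\<in>\<K>. {x \<in> topspace (X i). wedge_incl p i x \<in> S})"
        by auto
      moreover have "openin (X i) \<dots>"
        using K that by (intro openin_Union) auto
      ultimately show ?thesis by simp
    qed
    with K show "\<Union>\<K> \<subseteq> wedge_carrier I X p"
      "\<forall>i\<in>I. openin (X i) {x \<in> topspace (X i). wedge_incl p i x \<in> \<Union>\<K>}"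
      by auto
  qed
  then show ?thesis
    by (simp add: wedge_def)
qed

lemma topspace_wedge: "topspace (wedge I X p) = wedge_carrier I X p"
proof
  show "topspace (wedge I X p) \<subseteq> wedge_carrier I X p"
    using openin_wedge openin_topspace by metis
  have "openin (X i) {x \<in> topspace (X i). wedge_incl p i x \<in> wedge_carrier I X p}"
    if "i \<in> I" for i
  proof -
    have "{x \<in> topspace (X i). wedge_incl p i x \<in> wedge_carrier I X p} = topspace (X i)"
      using that by (auto simp: wedge_carrier_def)
    then show ?thesis by simp
  qed
  then show "wedge_carrier I X p \<subseteq> topspace (wedge I X p)"
    by (intro openin_subset) (simp add: openin_wedge)
qed

definition sphere_base :: "nat \<Rightarrow> real" where
  "sphere_base = (\<lambda>k. if k = 0 then 1 else 0)"

lemma sphere_base_in_nsphere: "sphere_base \<in> topspace (nsphere d)"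
  by (simp add: nsphere topspace_subtopology sphere_base_def power2_eq_square
      if_distrib[where f = "\<lambda>x. x * _"] cong: if_cong)

definition bouquet :: "'i set \<Rightarrow> ('i \<Rightarrow> nat) \<Rightarrow> ('i \<times> (nat \<Rightarrow> real)) option topology" where
  "bouquet I d = wedge I (\<lambda>i. nsphere (d i)) (\<lambda>_. sphere_base)"

text \<open>The standard sphere of dimension \<open>d \<ge> -1\<close>; in dimension \<open>-1\<close> it is the empty space.\<close>

definition sphere_space :: "int \<Rightarrow> (nat \<Rightarrow> real) topology" where
  "sphere_space d = (if d < 0 then trivial_topology else nsphere (nat d))"

text \<open>
  The bouquet for \<open>n\<close> has one sphere for each of the following collections \<open>S\<close>, of dimension
  \<open>card S - 1\<close>. For \<open>n \<ge> 2\<close> every such \<open>S\<close> is finite and nonempty, so the truncated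
  subtraction is harmless.
\<close>

definition sphere_collections :: "nat \<Rightarrow> nat set set" where
  "sphere_collections n = {S. S \<subseteq> proper_divisors n - {1} \<and> \<Sum>S = n - 1}"

lemma sphere_collections_finite_nonempty:
  assumes "2 \<le> n" and "S \<in> sphere_collections n"
  shows "finite S" and "S \<noteq> {}"
proof -
  show "finite S"
    using assms finite_proper_divisors[of n]
    by (auto simp: sphere_collections_def intro: finite_subset)
  show "S \<noteq> {}"
    using assms by (auto simp: sphere_collections_def)
qed

end

theory Submission
  imports Defs
begin

text \<open>
  A face of \<open>Div_complex n\<close> avoiding the vertex 1 can be enlarged by 1 unless its sum is \<open>n - 1\<close>, in
  which case it is a facet. So the complex is a cone with apex 1 to which the simplices spanned by the
  sphere collections are glued along their boundaries, and collapsing the contractible cone turns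
  each of these simplices into a sphere. The collapse is a homotopy equivalence because the
  contraction of the cone extends to an explicit homotopy of the whole realization.

  For the converse in (2), each sphere of a bouquet is a retract of it. If the bouquet is homotopy
  equivalent to a sphere, reduced homology forces the two spheres to have the same dimension, which
  for \<open>divisor_count n - 3\<close> leaves only the collection of all proper divisors except 1.
\<close>

section \<open>Homotopy equivalences from quotient maps and reduced homology\<close>

text \<open>Collapsing the cone identifies points only inside it. A homotopy of the realization that
  starts at the identity therefore descends to the bouquet once it keeps the cone in itself, and its
  end map factors through the collapse once it is constant on the cone; that factor is the homotopy
  inverse. The obstacle is continuity of such a homotopy where the facets meet the cone. It is met
  by a function \<open>depth S\<close> that is positive exactly in the interior of the facet
  \<open>S\<close>. At most one of these depths is nonzero at any point, so the homotopy can be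
  written with finite sums over all facets, and the depth of a point decides how much of the cone
  contraction it undergoes.\<close>

lemma homotopy_equivalent_space_quotient:
  assumes q: "quotient_map X Y q"
    and h: "continuous_map (prod_topology (top_of_set {0..1::real}) X) X h"
    and h0: "\<And>x. x \<in> topspace X \<Longrightarrow> h (0, x) = x"
    and hq: "\<And>t x y. \<lbrakk>t \<in> {0..1}; x \<in> topspace X; y \<in> topspace X; q x = q y\<rbrakk>
               \<Longrightarrow> q (h (t, x)) = q (h (t, y))"
    and h1: "\<And>x y. \<lbrakk>x \<in> topspace X; y \<in> topspace X; q x = q y\<rbrakk> \<Longrightarrow> h (1, x) = h (1, y)"
  shows "X homotopy_equivalent_space Y"
proof -
  let ?I = "top_of_set {0..1::real}"
  have contq: "continuous_map X Y q"
    using q quotient_imp_continuous_map by blast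
  have "continuous_map X (prod_topology ?I X) (\<lambda>x. (1, x))"
    by (intro continuous_intros) auto
  then have "continuous_map X X (h \<circ> (\<lambda>x. (1, x)))"
    using h continuous_map_compose by blast
  then obtain g where g: "continuous_map Y X g"
    and gq: "\<And>x. x \<in> topspace X \<Longrightarrow> g (q x) = (h \<circ> (\<lambda>x. (1, x))) x"
    by (rule quotient_map_lift_exists[OF q]) (auto intro: h1)
  \<comment> \<open>The product of a quotient map with a locally compact Hausdorff space is again a
    quotient map; this lets the whole homotopy descend, not just its end map.\<close>
  have "locally_compact_space ?I" "Hausdorff_space ?I"
    by (auto simp: compact_imp_locally_compact_space compact_space_subtopology
        Hausdorff_space_subtopology Hausdorff_space_euclidean)
  then have Q: "quotient_map (prod_topology ?I X) (prod_topology ?I Y) (\<lambda>(t,x). (t, q x))"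
    using quotient_map_prod_right q by blast
  have "continuous_map (prod_topology ?I X) Y (q \<circ> h)"
    using h contq continuous_map_compose by blast
  then obtain H where H: "continuous_map (prod_topology ?I Y) Y H"
    and Hq: "\<And>z. z \<in> topspace (prod_topology ?I X) \<Longrightarrow> H ((\<lambda>(t,x). (t, q x)) z) = (q \<circ> h) z"
    by (rule quotient_map_lift_exists[OF Q]) (auto intro: hq)
  have Hq': "H (t, q x) = q (h (t, x))" if "t \<in> {0..1}" "x \<in> topspace X" for t x
    using Hq[of "(t,x)"] that by simp
  have "homotopic_with (\<lambda>x. True) X X id (g \<circ> q)"
    by (subst homotopic_with) (use h h0 gq in auto)
  moreover have "homotopic_with (\<lambda>x. True) Y Y id (q \<circ> g)"
  proof (subst homotopic_with, simp, intro exI conjI ballI)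
    fix y assume "y \<in> topspace Y"
    then obtain x where x: "x \<in> topspace X" "y = q x"
      using q by (auto simp: quotient_map_def)
    show "H (0, y) = id y" "H (1, y) = (q \<circ> g) y"
      using x Hq' h0 gq by auto
  qed (use H in auto)
  ultimately show ?thesis
    unfolding homotopy_equivalent_space_def
    using contq g by (blast intro: homotopic_with_sym[THEN iffD1])
qed

text \<open>On homology \<open>g \<circ> f\<close> acts as the identity, so every class of
  \<open>X\<close> returns to itself after passing through the trivial group of
  \<open>Y\<close>.\<close>

lemma trivial_reduced_homology_group_homotopy_retract:
  assumes f: "continuous_map X Y f" and g: "continuous_map Y X g"
    and gf: "homotopic_with (\<lambda>x. True) X X (g \<circ> f) id"
    and triv: "trivial_group (reduced_homology_group p Y)"
  shows "trivial_group (reduced_homology_group p X)"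
proof -
  have "x = \<one>\<^bsub>reduced_homology_group p X\<^esub>"
    if x: "x \<in> carrier (reduced_homology_group p X)" for x
  proof -
    let ?f = "hom_induced p X {} Y {} f" and ?g = "hom_induced p Y {} X {} g"
    have xh: "x \<in> carrier (homology_group p X)"
      using x carrier_reduced_homology_group_subset by blast
    have "?g (?f x) = hom_induced p X {} X {} (g \<circ> f) x"
      using f g by (simp add: hom_induced_compose')
    also have "\<dots> = x"
      using gf xh hom_induced_id homology_homotopy_empty by metis
    finally have "?g (?f x) = x" .
    moreover have "?f x \<in> carrier (reduced_homology_group p Y)"
      using hom_in_carrier[OF hom_induced_reduced_hom x] .
    then have "?f x = \<one>\<^bsub>reduced_homology_group p Y\<^esub>"
      using triv by (auto simp: trivial_group_def)
    moreover have "?g \<one>\<^bsub>reduced_homology_group p Y\<^esub> = \<one>\<^bsub>reduced_homology_group p X\<^esub>"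
      by (intro hom_one[OF hom_induced_reduced_hom]) auto
    ultimately show ?thesis by simp
  qed
  then show ?thesis
    by (auto simp: group.trivial_group_alt)
qed

text \<open>The identity of the reduced homology of \<open>nsphere k\<close> in degree
  \<open>k\<close>, a nontrivial group, factors through that of \<open>nsphere d\<close>, which
  lives in degree \<open>d\<close> alone.\<close>

lemma not_homotopy_retract_nsphere:
  assumes "continuous_map (nsphere k) Y f" "continuous_map Y (nsphere k) g"
    and "homotopic_with (\<lambda>x. True) (nsphere k) (nsphere k) (g \<circ> f) id"
    and "Y homotopy_equivalent_space nsphere d"
  shows "k = d"
proof (rule ccontr)
  assume "k \<noteq> d"
  then have "trivial_group (reduced_homology_group (int k) (nsphere d))"
    by (simp add: trivial_reduced_homology_group_nsphere)
  then have "trivial_group (reduced_homology_group (int k) Y)"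
    using isomorphic_group_triviality
      [OF homotopy_equivalent_space_imp_isomorphic_reduced_homology_groups[OF assms(4)]]
    by simp
  then have "trivial_group (reduced_homology_group (int k) (nsphere k))"
    using assms trivial_reduced_homology_group_homotopy_retract by blast
  then show False
    by (simp add: trivial_reduced_homology_group_nsphere)
qed

section \<open>Wedges\<close>

lemma continuous_map_wedge_incl:
  assumes "i \<in> I"
  shows "continuous_map (X i) (wedge I X p) (wedge_incl p i)"
  using assms
  by (auto simp: continuous_map_def topspace_wedge wedge_carrier_def openin_wedge)

text \<open>The final topology reduces continuity to the single summands. The value at
  \<open>None\<close> is a separate condition because for empty \<open>I\<close> no summand reaches
  the base point.\<close>

lemma continuous_map_from_wedge:
  assumes "\<And>i. i \<in> I \<Longrightarrow> continuous_map (X i) Y (\<lambda>x. f (wedge_incl p i x))"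
    and "f None \<in> topspace Y"
  shows "continuous_map (wedge I X p) Y f"
  unfolding continuous_map_def
proof (intro conjI allI impI)
  show "f \<in> topspace (wedge I X p) \<rightarrow> topspace Y"
    using assms continuous_map_image_subset_topspace
    by (fastforce simp: topspace_wedge wedge_carrier_def)
  fix U assume U: "openin Y U"
  show "openin (wedge I X p) {x \<in> topspace (wedge I X p). f x \<in> U}"
    unfolding openin_wedge topspace_wedge
  proof (intro conjI ballI)
    fix i assume i: "i \<in> I"
    have "{x \<in> topspace (X i). wedge_incl p i x \<in> {x \<in> wedge_carrier I X p. f x \<in> U}}
        = {x \<in> topspace (X i). f (wedge_incl p i x) \<in> U}"
      using i by (auto simp: wedge_carrier_def)
    then show "openin (X i) {x \<in> topspace (X i). wedge_incl p i x \<in> {x \<in> wedge_carrier I X p. f x \<in> U}}"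
      using assms(1)[OF i] U by (simp add: continuous_map_def)
  qed auto
qed

definition wedge_proj :: "('i \<Rightarrow> 'a) \<Rightarrow> 'i \<Rightarrow> ('i \<times> 'a) option \<Rightarrow> 'a" where
  "wedge_proj p i z = (case z of None \<Rightarrow> p i | Some (j, x) \<Rightarrow> if j = i then x else p i)"

lemma wedge_proj_incl: "wedge_proj p i (wedge_incl p j x) = (if j = i then x else p i)"
  by (auto simp: wedge_proj_def wedge_incl_def)

lemma continuous_map_wedge_proj:
  assumes "p i \<in> topspace (X i)"
  shows "continuous_map (wedge I X p) (X i) (wedge_proj p i)"
proof (rule continuous_map_from_wedge)
  fix j assume "j \<in> I"
  show "continuous_map (X j) (X i) (\<lambda>x. wedge_proj p i (wedge_incl p j x))"
    using assms by (cases "j = i") (simp_all add: wedge_proj_incl)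
qed (simp add: assms wedge_proj_def)

lemma homeomorphic_space_wedge_singleton:
  assumes "p i \<in> topspace (X i)"
  shows "wedge {i} X p homeomorphic_space X i"
  unfolding homeomorphic_space_def homeomorphic_maps_def
proof (intro exI conjI ballI)
  show "continuous_map (wedge {i} X p) (X i) (wedge_proj p i)"
    using assms by (rule continuous_map_wedge_proj)
  show "continuous_map (X i) (wedge {i} X p) (wedge_incl p i)"
    by (simp add: continuous_map_wedge_incl)
  fix z assume "z \<in> topspace (wedge {i} X p)"
  then show "wedge_incl p i (wedge_proj p i z) = z"
    by (auto simp: topspace_wedge wedge_carrier_def wedge_incl_def wedge_proj_def)
qed (simp add: wedge_proj_incl)

lemma contractible_space_wedge_empty: "contractible_space (wedge {} X p)"
  by (rule contractible_space_subset_singleton)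
     (auto simp: topspace_wedge wedge_carrier_def)

text \<open>Sending all other summands to the base point retracts the bouquet onto the sphere
  \<open>i\<close>, so the homology of the whole bouquet never has to be computed.\<close>

lemma bouquet_sphere_dimension:
  assumes "i \<in> I" and "bouquet I d homotopy_equivalent_space nsphere k"
  shows "d i = k"
proof (rule not_homotopy_retract_nsphere)
  let ?X = "\<lambda>i. nsphere (d i)"
  show "continuous_map (nsphere (d i)) (bouquet I d) (wedge_incl (\<lambda>_. sphere_base) i)"
    using assms(1) continuous_map_wedge_incl[of i I ?X] by (simp add: bouquet_def)
  show "continuous_map (bouquet I d) (nsphere (d i)) (wedge_proj (\<lambda>_. sphere_base) i)"
    using continuous_map_wedge_proj[of "\<lambda>_. sphere_base" i ?X]
    by (simp add: bouquet_def sphere_base_in_nsphere)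
  show "homotopic_with (\<lambda>x. True) (nsphere (d i)) (nsphere (d i))
          (wedge_proj (\<lambda>_. sphere_base) i \<circ> wedge_incl (\<lambda>_. sphere_base) i) id"
    by (rule homotopic_with_equal) (simp_all add: o_def wedge_proj_incl continuous_map_id[unfolded id_def])
qed fact

section \<open>A simplex modulo its boundary\<close>

lemma continuous_map_real_Min:
  fixes f :: "'i \<Rightarrow> 'a \<Rightarrow> real"
  assumes "finite I" "I \<noteq> {}" "\<And>i. i \<in> I \<Longrightarrow> continuous_map X euclideanreal (f i)"
  shows "continuous_map X euclideanreal (\<lambda>x. Min ((\<lambda>i. f i x) ` I))"
  using assms
proof (induction rule: finite_ne_induct)
  case (insert i I)
  have "(\<lambda>x. Min ((\<lambda>i. f i x) ` insert i I)) = (\<lambda>x. min (f i x) (Min ((\<lambda>i. f i x) ` I)))"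
    using insert by (intro ext) (simp add: Min_insert)
  then show ?case
    using insert by (auto intro: continuous_map_real_min)
qed simp

text \<open>For barycentric coordinates on the simplex \<open>S\<close> this is a radial coordinate:
  0 exactly on the boundary and, thanks to the factor \<open>card S\<close>, 1 at the
  barycentre.\<close>

definition depth :: "'a set \<Rightarrow> ('a \<Rightarrow> real) \<Rightarrow> real" where
  "depth S x = real (card S) * Min (x ` S)"

lemma depth_nonneg:
  assumes "finite S" "S \<noteq> {}" "\<And>v. v \<in> S \<Longrightarrow> 0 \<le> x v"
  shows "0 \<le> depth S x"
  using assms by (simp add: depth_def)

lemma depth_le:
  assumes "finite S" "v \<in> S"
  shows "depth S x \<le> real (card S) * x v"
  using assms by (simp add: depth_def mult_left_mono)

lemma depth_attained:
  assumes "finite S" "S \<noteq> {}"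
  obtains v where "v \<in> S" "depth S x = real (card S) * x v"
proof -
  have "Min (x ` S) \<in> x ` S"
    using assms by (intro Min_in) auto
  then show ?thesis
    using that by (auto simp: depth_def)
qed

lemma depth_pos_iff:
  assumes "finite S" "S \<noteq> {}"
  shows "0 < depth S x \<longleftrightarrow> (\<forall>v\<in>S. 0 < x v)"
  using assms by (auto simp: depth_def zero_less_mult_iff card_gt_0_iff)

lemma depth_le_sum:
  assumes "finite S"
  shows "depth S x \<le> sum x S"
proof -
  have "(\<Sum>v\<in>S. Min (x ` S)) \<le> sum x S"
    using assms by (intro sum_mono) auto
  then show ?thesis by (simp add: depth_def)
qed

lemma continuous_map_depth:
  assumes "finite S" "S \<noteq> {}"
    and "\<And>v. v \<in> S \<Longrightarrow> continuous_map X euclideanreal (\<lambda>z. f z v)"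
  shows "continuous_map X euclideanreal (\<lambda>z. depth S (f z))"
  unfolding depth_def
  using assms continuous_map_real_Min[of S X "\<lambda>v z. f z v"]
  by (intro continuous_intros) auto

definition edge_norm2 :: "nat \<Rightarrow> (nat \<Rightarrow> real) \<Rightarrow> real" where
  "edge_norm2 d t = (\<Sum>i\<le>d. (t i - t 0)\<^sup>2)"

text \<open>Inverse stereographic projection, from \<open>sphere_base\<close>, of the point with coordinates
  \<open>(t i - t 0) / depth {..d} t\<close> for \<open>1 \<le> i \<le> d\<close>, with denominators cleared so that it makes sense
  on the boundary of the simplex too.\<close>

definition simplex_to_sphere :: "nat \<Rightarrow> (nat \<Rightarrow> real) \<Rightarrow> nat \<Rightarrow> real" where
  "simplex_to_sphere d t i =
     (if i = 0 then (edge_norm2 d t - (depth {..d} t)\<^sup>2) / (edge_norm2 d t + (depth {..d} t)\<^sup>2)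
      else if i \<le> d then 2 * depth {..d} t * (t i - t 0) / (edge_norm2 d t + (depth {..d} t)\<^sup>2)
      else 0)"

lemma edge_norm2_nonneg: "0 \<le> edge_norm2 d t"
  by (simp add: edge_norm2_def sum_nonneg)

lemma standard_simplex_depth_nonneg:
  "t \<in> standard_simplex d \<Longrightarrow> 0 \<le> depth {..d} t"
  by (rule depth_nonneg) (auto simp: standard_simplex_def)

text \<open>The two summands cannot vanish together: zero edge norm forces all coordinates to be
  equal, and at the barycentre the depth is 1.\<close>

lemma standard_simplex_denominator_pos:
  assumes t: "t \<in> standard_simplex d"
  shows "0 < edge_norm2 d t + (depth {..d} t)\<^sup>2"
proof (cases "edge_norm2 d t = 0")
  case True
  then have "\<forall>i\<in>{..d}. (t i - t 0)\<^sup>2 = 0"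
    unfolding edge_norm2_def
    by (rule iffD1[OF sum_nonneg_eq_0_iff[OF finite_atMost zero_le_power2]])
  then have eq: "t i = t 0" if "i \<le> d" for i
    by (rule bspec[of _ _ i, THEN zero_eq_power2[THEN iffD1], THEN eq_iff_diff_eq_0[THEN iffD2]])
       (simp add: that)
  have "t ` {..d} = {t 0}"
    using image_cong[OF refl eq, of "{..d}"] by (simp add: image_constant_conv)
  then have "depth {..d} t = (\<Sum>i\<le>d. t 0)"
    by (simp add: depth_def)
  also have "\<dots> = (\<Sum>i\<le>d. t i)"
    by (rule sum.cong[OF refl eq[symmetric]]) simp
  also have "\<dots> = 1"
    using t by (simp add: standard_simplex_def)
  finally show ?thesis using True by simp
next
  case False
  then have "0 < edge_norm2 d t"
    using edge_norm2_nonneg[of d t] by linarith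
  then show ?thesis
    by (intro add_pos_nonneg) auto
qed

lemma simplex_to_sphere_in_nsphere:
  assumes t: "t \<in> standard_simplex d"
  shows "simplex_to_sphere d t \<in> topspace (nsphere d)"
proof -
  let ?q = "edge_norm2 d t" and ?u = "depth {..d} t"
  let ?D = "?q + ?u\<^sup>2"
  have D: "?D > 0"
    by (rule standard_simplex_denominator_pos[OF t])
  have "(\<Sum>i\<le>d. (simplex_to_sphere d t i)\<^sup>2)
      = ((?q - ?u\<^sup>2) / ?D)\<^sup>2 + (\<Sum>i\<in>{..d} - {0}. (2 * ?u * (t i - t 0) / ?D)\<^sup>2)"
    by (subst sum.remove[of _ 0]) (auto simp: simplex_to_sphere_def intro!: sum.cong)
  also have "(\<Sum>i\<in>{..d} - {0}. (2 * ?u * (t i - t 0) / ?D)\<^sup>2) = (\<Sum>i\<le>d. (2 * ?u * (t i - t 0) / ?D)\<^sup>2)"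
    by (subst (2) sum.remove[of _ 0]) auto
  also have "\<dots> = (2 * ?u / ?D)\<^sup>2 * ?q"
    by (simp add: edge_norm2_def sum_distrib_left power_mult_distrib power_divide)
  also have "((?q - ?u\<^sup>2) / ?D)\<^sup>2 + (2 * ?u / ?D)\<^sup>2 * ?q = ((?q - ?u\<^sup>2)\<^sup>2 + 4 * ?u\<^sup>2 * ?q) / ?D\<^sup>2"
    by (simp add: power_divide add_divide_distrib power_mult_distrib)
  also have "(?q - ?u\<^sup>2)\<^sup>2 + 4 * ?u\<^sup>2 * ?q = ?D\<^sup>2"
    by (simp add: power2_eq_square algebra_simps)
  finally show ?thesis
    using D by (simp add: nsphere simplex_to_sphere_def)
qed

lemma continuous_map_simplex_to_sphere:
  "continuous_map (subtopology (powertop_real UNIV) (standard_simplex d)) (nsphere d)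
     (simplex_to_sphere d)"
proof -
  let ?X = "subtopology (powertop_real UNIV) (standard_simplex d)"
  have c: "continuous_map ?X euclideanreal (\<lambda>t. t i)" for i
    by (intro continuous_map_from_subtopology continuous_map_product_projection) simp
  have u: "continuous_map ?X euclideanreal (depth {..d})"
    using continuous_map_depth[of "{..d}" ?X "\<lambda>t. t"] c by auto
  have q: "continuous_map ?X euclideanreal (edge_norm2 d)"
    unfolding edge_norm2_def by (intro continuous_intros c) auto
  have nz: "edge_norm2 d t + (depth {..d} t)\<^sup>2 \<noteq> 0" if "t \<in> topspace ?X" for t
    using standard_simplex_denominator_pos that by force
  have "continuous_map ?X euclideanreal (\<lambda>t. simplex_to_sphere d t i)" for i
    unfolding simplex_to_sphere_def
    by (cases "i = 0"; cases "i \<le> d"; simp; intro continuous_intros c u q nz; assumption)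
  then show ?thesis
    using simplex_to_sphere_in_nsphere
    by (auto simp: nsphere continuous_map_in_subtopology continuous_map_componentwise_UNIV)
qed

text \<open>The zeroth coordinate differs from 1 by \<open>2 * u\<^sup>2 / D\<close>, with
  \<open>u\<close> the depth and \<open>D\<close> the denominator.\<close>

lemma simplex_to_sphere_eq_base_iff:
  assumes t: "t \<in> standard_simplex d"
  shows "simplex_to_sphere d t = sphere_base \<longleftrightarrow> depth {..d} t = 0"
proof
  assume "depth {..d} t = 0"
  then show "simplex_to_sphere d t = sphere_base"
    using standard_simplex_denominator_pos[OF t]
    by (auto simp: simplex_to_sphere_def sphere_base_def)
next
  assume "simplex_to_sphere d t = sphere_base"
  then have "simplex_to_sphere d t 0 = 1"
    by (simp add: sphere_base_def)
  then show "depth {..d} t = 0"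
    using standard_simplex_denominator_pos[OF t]
    by (simp add: simplex_to_sphere_def field_simps)
qed

text \<open>Since coordinates sum to 1, proportional edge vectors mean that \<open>s\<close> is
  displaced from the barycentre by \<rho> times the displacement of \<open>t\<close>. Evaluating
  \<open>s\<close> at a vertex where \<open>t\<close> is smallest bounds its depth by
  \<open>\<rho> * depth {..d} t + 1 - \<rho>\<close>, and comparison with the assumed depth gives
  the claim.\<close>

lemma standard_simplex_depth_ratio_le:
  assumes s: "s \<in> standard_simplex d" and t: "t \<in> standard_simplex d"
    and \<rho>: "\<And>i. i \<le> d \<Longrightarrow> s i - s 0 = \<rho> * (t i - t 0)"
    and u: "depth {..d} s = \<rho> * depth {..d} t"
  shows "\<rho> \<le> 1" and "\<rho> = 1 \<Longrightarrow> s = t"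
proof -
  have sums: "(\<Sum>i\<le>d. s i) = 1" "(\<Sum>i\<le>d. t i) = 1"
    using s t by (auto simp: standard_simplex_def)
  have "(\<Sum>i\<le>d. s i - s 0) = \<rho> * (\<Sum>i\<le>d. t i - t 0)"
    using \<rho> by (simp add: sum_distrib_left)
  then have *: "1 - real (Suc d) * s 0 = \<rho> * (1 - real (Suc d) * t 0)"
    using sums by (simp add: sum_subtractf)
  obtain i where i: "i \<in> {..d}" "depth {..d} t = real (card {..d}) * t i"
    by (rule depth_attained[of "{..d}" t]) auto
  have "depth {..d} s \<le> real (Suc d) * s i"
    using depth_le[of "{..d}" i s] i by simp
  also have "\<dots> = real (Suc d) * (\<rho> * (t i - t 0)) + real (Suc d) * s 0"
    using \<rho>[of i] i by (simp flip: distrib_left)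
  also have "\<dots> = \<rho> * depth {..d} t + 1 - \<rho>"
    using i * by (simp add: algebra_simps)
  finally show "\<rho> \<le> 1" using u by simp
  assume 1: "\<rho> = 1"
  then have "s 0 = t 0" using * by simp
  then show "s = t"
    using \<rho> 1 s t by (intro ext, rename_tac i, case_tac "i \<le> d") (auto simp: standard_simplex_def)
qed

text \<open>Stereographic projection recovers the edge coordinates divided by the depth, so the edge
  coordinates of \<open>s\<close> and \<open>t\<close> agree up to the ratio of the depths. The
  preceding lemma, applied in both directions, bounds this ratio and its inverse by 1.\<close>

lemma simplex_to_sphere_inj:
  assumes s: "s \<in> standard_simplex d" and t: "t \<in> standard_simplex d"
    and eq: "simplex_to_sphere d s = simplex_to_sphere d t"
    and ne: "simplex_to_sphere d s \<noteq> sphere_base"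
  shows "s = t"
proof -
  define u where "u = depth {..d} s"
  define v where "v = depth {..d} t"
  define D where "D = edge_norm2 d s + u\<^sup>2"
  define E where "E = edge_norm2 d t + v\<^sup>2"
  have D: "D > 0" and E: "E > 0"
    using standard_simplex_denominator_pos s t by (auto simp: D_def E_def u_def v_def)
  have u: "u > 0" and v: "v > 0"
    using simplex_to_sphere_eq_base_iff[OF s] simplex_to_sphere_eq_base_iff[OF t] eq ne
      standard_simplex_depth_nonneg[OF s] standard_simplex_depth_nonneg[OF t]
    by (auto simp: u_def v_def)
  have "(D - 2 * u\<^sup>2) / D = (E - 2 * v\<^sup>2) / E"
    using fun_cong[OF eq, of 0] by (simp add: simplex_to_sphere_def D_def E_def u_def v_def)
  then have uv: "u\<^sup>2 * E = v\<^sup>2 * D"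
    using D E by (simp add: field_simps)
  have z: "s i - s 0 = (u / v) * (t i - t 0)" if i: "i \<le> d" for i
  proof (cases "i = 0")
    case False
    then have "2 * u * (s i - s 0) / D = 2 * v * (t i - t 0) / E"
      using fun_cong[OF eq, of i] i by (simp add: simplex_to_sphere_def D_def E_def u_def v_def)
    then have "u * (s i - s 0) * E = v * (t i - t 0) * D"
      using D E by (simp add: field_simps)
    then have "v * (u * (s i - s 0) * E) = v * (v * (t i - t 0) * D)"
      by (rule arg_cong)
    then have "v * u * (s i - s 0) * E = (t i - t 0) * (v\<^sup>2 * D)"
      by (simp add: algebra_simps power2_eq_square)
    also have "\<dots> = (t i - t 0) * (u\<^sup>2 * E)"
      by (simp only: uv)
    finally have "(u * E) * (v * (s i - s 0)) = (u * E) * (u * (t i - t 0))"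
      by (simp add: algebra_simps power2_eq_square)
    then have "v * (s i - s 0) = u * (t i - t 0)"
      using u E by simp
    then show ?thesis
      using v by (simp add: field_simps)
  qed simp
  have ratio: "depth {..d} s = (u / v) * depth {..d} t" "depth {..d} t = (v / u) * depth {..d} s"
    using u v by (simp_all flip: u_def v_def)
  have le1: "u / v \<le> 1"
    by (rule standard_simplex_depth_ratio_le(1)[OF s t z ratio(1)])
  have "t i - t 0 = (v / u) * (s i - s 0)" if "i \<le> d" for i
    unfolding z[OF that] using u v by simp
  then have "v / u \<le> 1"
    by (rule standard_simplex_depth_ratio_le(1)[OF t s _ ratio(2)])
  with le1 have uv1: "u / v = 1"
    using u v by (simp add: field_simps)
  show ?thesis
    by (rule standard_simplex_depth_ratio_le(2)[OF s t z ratio(1) uv1])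
qed

lemma simplex_to_sphere_surj:
  assumes d: "0 < d"
  shows "simplex_to_sphere d ` standard_simplex d = topspace (nsphere d)"
proof
  show "simplex_to_sphere d ` standard_simplex d \<subseteq> topspace (nsphere d)"
    using simplex_to_sphere_in_nsphere by blast
  show "topspace (nsphere d) \<subseteq> simplex_to_sphere d ` standard_simplex d"
  proof
    fix y assume y: "y \<in> topspace (nsphere d)"
    then have y1: "(\<Sum>i\<le>d. (y i)\<^sup>2) = 1" and yd: "\<And>i. i > d \<Longrightarrow> y i = 0"
      by (auto simp: nsphere)
    have rest: "(\<Sum>i\<in>{..d} - {0}. (y i)\<^sup>2) = 1 - (y 0)\<^sup>2"
      using y1 by (subst (asm) sum.remove[of _ 0]) auto
    show "y \<in> simplex_to_sphere d ` standard_simplex d"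
    proof (cases "y = sphere_base")
      case True
      let ?t = "\<lambda>j::nat. if j = 0 then 1 else 0 :: real"
      have t: "?t \<in> standard_simplex d" by simp
      \<comment> \<open>Coordinate \<open>d\<close> is not the vertex 0 because
        \<open>0 < d\<close>. For \<open>d = 0\<close> the simplex has no boundary and the base
        point would be missed.\<close>
      have "depth {..d} ?t \<le> real (card {..d}) * ?t d"
        by (rule depth_le) auto
      then have "depth {..d} ?t = 0"
        using standard_simplex_depth_nonneg[OF t] d by simp
      then show ?thesis
        using simplex_to_sphere_eq_base_iff[OF t] True t by (metis imageI)
    next
      case False
      have y0: "y 0 < 1"
      proof (rule ccontr)
        assume "\<not> y 0 < 1"
        then have "1 \<le> (y 0)\<^sup>2" by simp
        moreover have "0 \<le> (\<Sum>i\<in>{..d} - {0}. (y i)\<^sup>2)"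
          by (simp add: sum_nonneg)
        ultimately have "(\<Sum>i\<in>{..d} - {0}. (y i)\<^sup>2) = 0" "(y 0)\<^sup>2 = 1"
          using rest by auto
        then have "\<And>i. i \<in> {..d} - {0} \<Longrightarrow> y i = 0" "y 0 = 1"
          using \<open>\<not> y 0 < 1\<close> by (auto simp: sum_nonneg_eq_0_iff power2_eq_1_iff)
        then have "y = sphere_base"
          using yd by (auto simp: sphere_base_def fun_eq_iff) (meson not_le)
        with False show False ..
      qed
      \<comment> \<open>\<open>p\<close> is the stereographic projection of \<open>y\<close>, and
        \<open>w\<close> its translate with coordinate sum 0. The barycentre plus
        \<open>l * w\<close> has edge coordinates \<open>l * p i\<close> and depth
        \<open>1 - l * \<gamma>\<close>; the value of \<open>l\<close> is the one that makes this
        depth equal to \<open>l\<close>, so that the quotients are the \<open>p i\<close>.\<close>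
      define p where "p i = (if i = 0 then 0 else y i / (1 - y 0))" for i
      define w where "w i = p i - sum p {..d} / real (Suc d)" for i
      define \<gamma> where "\<gamma> = - depth {..d} w"
      define l where "l = 1 / (1 + \<gamma>)"
      define t where "t i = (if i \<le> d then 1 / real (Suc d) + l * w i else 0)" for i
      have w0: "sum w {..d} = 0"
        by (simp add: w_def sum_subtractf)
      have "\<gamma> \<ge> 0"
        using depth_le_sum[of "{..d}" w] w0 by (simp add: \<gamma>_def)
      then have l: "l > 0" and l\<gamma>: "1 - l * \<gamma> = l"
        by (auto simp: l_def field_simps)
      have lw: "real (Suc d) * (1 / real (Suc d) + l * w i) = 1 + l * (real (Suc d) * w i)" for i
        by (simp add: field_simps)
      have ge: "real (Suc d) * t i \<ge> l" if "i \<le> d" for i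
      proof -
        have "real (Suc d) * w i \<ge> - \<gamma>"
          using depth_le[of "{..d}" i w] that by (simp add: \<gamma>_def)
        then have "l * (real (Suc d) * w i) \<ge> l * (- \<gamma>)"
          using l by (intro mult_left_mono) auto
        then show ?thesis
          using that l\<gamma> lw by (simp add: t_def)
      qed
      have tpos: "t i > 0" if "i \<le> d" for i
        using ge[OF that] l by (smt (verit) mult_nonneg_nonpos of_nat_0_le_iff)
      have tsum: "(\<Sum>i\<le>d. t i) = 1"
        using w0 by (simp add: t_def sum.distrib flip: sum_distrib_left)
      have t_le: "t i \<le> 1" for i
      proof (cases "i \<le> d")
        case True
        then have "t i \<le> (\<Sum>i\<le>d. t i)"
          using tpos by (intro member_le_sum) (auto intro: less_imp_le)
        then show ?thesis using tsum by simp
      qed (simp add: t_def)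
      have t: "t \<in> standard_simplex d"
        using tpos tsum t_le by (auto simp: standard_simplex_def t_def[of _] intro: less_imp_le
            dest!: not_le_imp_less)
      obtain k where k: "k \<in> {..d}" "depth {..d} w = real (card {..d}) * w k"
        by (rule depth_attained[of "{..d}" w]) auto
      have u: "depth {..d} t = l"
      proof (rule antisym)
        have "depth {..d} t \<le> real (Suc d) * t k"
          using depth_le[of "{..d}" k t] k by simp
        also have "\<dots> = l"
          using k l\<gamma> lw by (simp add: t_def \<gamma>_def)
        finally show "depth {..d} t \<le> l" .
        obtain j where "j \<in> {..d}" "depth {..d} t = real (card {..d}) * t j"
          by (rule depth_attained[of "{..d}" t]) auto
        then show "l \<le> depth {..d} t"
          using ge by simp
      qed
      have z: "t i - t 0 = l * p i" if "i \<le> d" for i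
        using that by (simp add: t_def w_def p_def algebra_simps)
      have P: "(\<Sum>i\<le>d. (p i)\<^sup>2) = (1 - (y 0)\<^sup>2) / (1 - y 0)\<^sup>2"
      proof -
        have "(\<Sum>i\<le>d. (p i)\<^sup>2) = (\<Sum>i\<in>{..d} - {0}. (y i / (1 - y 0))\<^sup>2)"
          by (subst sum.remove[of _ 0]) (auto simp: p_def intro!: sum.cong)
        also have "\<dots> = (\<Sum>i\<in>{..d} - {0}. (y i)\<^sup>2) / (1 - y 0)\<^sup>2"
          by (simp add: power_divide sum_divide_distrib)
        finally show ?thesis by (simp add: rest)
      qed
      have "(1 - (y 0)\<^sup>2) / (1 - y 0)\<^sup>2 = (1 + y 0) / (1 - y 0)"
        using y0 square_diff_one_factored[of "y 0"]
        by (simp add: divide_simps power2_eq_square) (simp add: algebra_simps)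
      then have q: "edge_norm2 d t = l\<^sup>2 * ((1 + y 0) / (1 - y 0))"
        using z P by (simp add: edge_norm2_def power_mult_distrib flip: sum_distrib_left)
      then have D: "edge_norm2 d t + (depth {..d} t)\<^sup>2 = 2 * l\<^sup>2 / (1 - y 0)"
        and N: "edge_norm2 d t - (depth {..d} t)\<^sup>2 = 2 * l\<^sup>2 * y 0 / (1 - y 0)"
        using y0 u by (simp_all add: field_simps)
      have "simplex_to_sphere d t i = y i" for i
      proof -
        consider "i = 0" | "0 < i" "i \<le> d" | "d < i" by linarith
        then show ?thesis
        proof cases
          case 1
          then show ?thesis
            using y0 l by (simp add: simplex_to_sphere_def D N)
        next
          case 2
          then have "simplex_to_sphere d t i = 2 * l * (l * p i) / (2 * l\<^sup>2 / (1 - y 0))"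
            using z[of i] by (simp add: simplex_to_sphere_def D) (simp add: u)
          also have "\<dots> = y i"
            using y0 l 2 by (simp add: p_def power2_eq_square)
          finally show ?thesis .
        qed (simp add: simplex_to_sphere_def yd)
      qed
      then show ?thesis
        using t by (metis ext imageI)
    qed
  qed
qed

lemma quotient_map_simplex_to_sphere:
  assumes "0 < d"
  shows "quotient_map (subtopology (powertop_real UNIV) (standard_simplex d)) (nsphere d)
           (simplex_to_sphere d)"
proof (rule continuous_imp_quotient_map)
  show "compact_space (subtopology (powertop_real UNIV) (standard_simplex d))"
    by (simp add: compact_space_subtopology compactin_standard_simplex)
  show "Hausdorff_space (nsphere d)"
    by (simp add: nsphere Hausdorff_space_subtopology Hausdorff_space_product_topology
        Hausdorff_space_euclidean)
qed (use assms in \<open>simp_all add: continuous_map_simplex_to_sphere simplex_to_sphere_surj\<close>)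

section \<open>A cone with additional facets\<close>

definition support :: "('a \<Rightarrow> real) \<Rightarrow> 'a set" where
  "support x = {v. x v \<noteq> 0}"

lemma topspace_geometric_realization:
  "topspace (geometric_realization K) =
     {x. (\<forall>v. 0 \<le> x v) \<and> support x \<in> K \<and> sum x (support x) = 1}"
  by (simp add: geometric_realization_def support_def)

text \<open>\<open>F\<close> may be any face containing the support, so vertices at which a formula
  happens to vanish need no case distinction.\<close>

lemma geometric_realizationI:
  assumes K: "simplicial_complex_on V K" and F: "F \<in> K"
    and nonneg: "\<And>v. 0 \<le> x v" and zero: "\<And>v. v \<notin> F \<Longrightarrow> x v = 0" and sum1: "sum x F = 1"
  shows "x \<in> topspace (geometric_realization K)"
proof -
  have fin: "finite F" using K F by (simp add: simplicial_complex_on_def)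
  have sub: "support x \<subseteq> F" using zero by (auto simp: support_def)
  have eq: "sum x (support x) = sum x F"
    using fin sub by (intro sum.mono_neutral_left) (auto simp: support_def)
  then have "support x \<noteq> {}" using sum1 by auto
  then have "support x \<in> K"
    using K F sub unfolding simplicial_complex_on_def by blast
  then show ?thesis
    using nonneg eq sum1 by (simp add: topspace_geometric_realization)
qed

lemma geometric_realization_sum:
  assumes "x \<in> topspace (geometric_realization K)" "finite F" "support x \<subseteq> F"
  shows "sum x F = 1"
proof -
  have "sum x (support x) = sum x F"
    using assms by (intro sum.mono_neutral_left) (auto simp: support_def)
  then show ?thesis
    using assms(1) by (simp add: topspace_geometric_realization)
qed

lemma continuous_map_geometric_realization_coordinate:
  "continuous_map (geometric_realization K) euclideanreal (\<lambda>x. x v)"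
  unfolding geometric_realization_def
  by (intro continuous_map_from_subtopology continuous_map_product_projection) simp

lemma continuous_map_into_geometric_realization:
  assumes "f \<in> topspace X \<rightarrow> topspace (geometric_realization K)"
    and "\<And>v. continuous_map X euclideanreal (\<lambda>z. f z v)"
  shows "continuous_map X (geometric_realization K) f"
  using assms
  by (auto simp: geometric_realization_def continuous_map_in_subtopology
      continuous_map_componentwise_UNIV)

section \<open>Coordinates identifying a facet with a standard simplex\<close>

definition vertex_enum :: "'a set \<Rightarrow> nat \<Rightarrow> 'a" where
  "vertex_enum S = (SOME e. bij_betw e {..card S - 1} S)"

lemma bij_betw_vertex_enum:
  assumes "finite S" "S \<noteq> {}"
  shows "bij_betw (vertex_enum S) {..card S - 1} S"
proof -
  have "card {..card S - 1} = card S"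
    using assms by (simp add: card_gt_0_iff Suc_leI)
  then have "\<exists>e. bij_betw e {..card S - 1} S"
    using assms by (intro finite_same_card_bij) auto
  then show ?thesis
    unfolding vertex_enum_def by (rule someI_ex)
qed

definition to_standard :: "'a set \<Rightarrow> ('a \<Rightarrow> real) \<Rightarrow> nat \<Rightarrow> real" where
  "to_standard S x i = (if i \<le> card S - 1 then x (vertex_enum S i) else 0)"

definition from_standard :: "'a set \<Rightarrow> (nat \<Rightarrow> real) \<Rightarrow> 'a \<Rightarrow> real" where
  "from_standard S t v = (if v \<in> S then t (inv_into {..card S - 1} (vertex_enum S) v) else 0)"

lemma depth_to_standard:
  assumes "finite S" "S \<noteq> {}"
  shows "depth {..card S - 1} (to_standard S x) = depth S x"
proof -
  have "to_standard S x ` {..card S - 1} = x ` vertex_enum S ` {..card S - 1}"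
    by (auto simp: to_standard_def image_image)
  also have "\<dots> = x ` S"
    using bij_betw_vertex_enum[OF assms] by (simp add: bij_betw_def)
  finally show ?thesis
    using assms by (simp add: depth_def card_gt_0_iff Suc_leI)
qed

lemma sum_to_standard:
  assumes "finite S" "S \<noteq> {}"
  shows "sum (to_standard S x) {..card S - 1} = sum x S"
proof -
  have "sum (to_standard S x) {..card S - 1} = (\<Sum>i\<le>card S - 1. x (vertex_enum S i))"
    by (rule sum.cong) (auto simp: to_standard_def)
  also have "\<dots> = sum x S"
    by (rule sum.reindex_bij_betw[OF bij_betw_vertex_enum[OF assms]])
  finally show ?thesis .
qed

lemma to_standard_from_standard:
  assumes "finite S" "S \<noteq> {}" and t: "t \<in> standard_simplex (card S - 1)"
  shows "to_standard S (from_standard S t) = t"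
proof
  fix i
  have b: "bij_betw (vertex_enum S) {..card S - 1} S"
    by (rule bij_betw_vertex_enum[OF assms(1,2)])
  show "to_standard S (from_standard S t) i = t i"
  proof (cases "i \<le> card S - 1")
    case True
    then have "vertex_enum S i \<in> S"
      using b by (auto simp: bij_betw_def)
    moreover have "inv_into {..card S - 1} (vertex_enum S) (vertex_enum S i) = i"
      using b True by (intro inv_into_f_f) (auto simp: bij_betw_def)
    ultimately show ?thesis
      using True by (simp add: to_standard_def from_standard_def)
  next
    case False
    then show ?thesis
      using t by (simp add: to_standard_def standard_simplex_def)
  qed
qed

lemma to_standard_eq_imp_eq_on:
  assumes "finite S" "S \<noteq> {}" and eq: "to_standard S x = to_standard S y" and v: "v \<in> S"
  shows "x v = y v"
proof -
  obtain i where "i \<le> card S - 1" "v = vertex_enum S i"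
    using bij_betw_vertex_enum[OF assms(1,2)] v by (auto simp: bij_betw_def)
  then show ?thesis
    using fun_cong[OF eq, of i] by (simp add: to_standard_def)
qed

text \<open>This isolates what is used about the divisor complex: the faces outside
  \<open>\<S>\<close> form a cone with apex \<open>a\<close>, and those in \<open>\<S>\<close> are
  facets avoiding it. By \<open>card_facet\<close> each of them has a nonempty boundary, so that its
  simplex alone covers the whole sphere.\<close>

locale cone_with_facets =
  fixes K :: "'a set set" and a :: 'a and \<S> :: "'a set set"
  assumes complex: "simplicial_complex_on UNIV K"
    and apex: "{a} \<in> K"
    and finite_facets: "finite \<S>"
    and facets_in: "\<S> \<subseteq> K"
    and facet_maximal: "\<lbrakk>S \<in> \<S>; F \<in> K; S \<subseteq> F\<rbrakk> \<Longrightarrow> F = S"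
    and apex_notin: "S \<in> \<S> \<Longrightarrow> a \<notin> S"
    and card_facet: "S \<in> \<S> \<Longrightarrow> 2 \<le> card S"
    and cone: "\<lbrakk>F \<in> K; F \<notin> \<S>\<rbrakk> \<Longrightarrow> insert a F \<in> K"
begin

abbreviation "X \<equiv> geometric_realization K"

lemma facet_finite: "S \<in> \<S> \<Longrightarrow> finite S"
  and facet_nonempty: "S \<in> \<S> \<Longrightarrow> S \<noteq> {}"
  using facets_in complex by (auto simp: simplicial_complex_on_def)

lemma subset_facet: "\<lbrakk>S \<in> \<S>; T \<in> \<S>; T \<subseteq> S\<rbrakk> \<Longrightarrow> T = S"
  using facet_maximal facets_in by blast

lemma nonneg: "x \<in> topspace X \<Longrightarrow> 0 \<le> x v"
  and support_in: "x \<in> topspace X \<Longrightarrow> support x \<in> K"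
  by (auto simp: topspace_geometric_realization)

lemma apex_in: "(\<lambda>v. if v = a then 1 else 0) \<in> topspace X"
  by (rule geometric_realizationI[OF complex apex]) auto

lemma support_finite: "x \<in> topspace X \<Longrightarrow> finite (support x)"
  using support_in complex by (auto simp: simplicial_complex_on_def)

lemma depth_facet_nonneg: "\<lbrakk>x \<in> topspace X; S \<in> \<S>\<rbrakk> \<Longrightarrow> 0 \<le> depth S x"
  by (intro depth_nonneg facet_finite facet_nonempty nonneg)

text \<open>Maximality of \<open>S\<close> turns \<open>S \<subseteq> support x\<close> into
  equality. Hence at most one facet has positive depth at a given point.\<close>

lemma depth_facet_pos_iff:
  assumes "x \<in> topspace X" "S \<in> \<S>"
  shows "0 < depth S x \<longleftrightarrow> support x = S"
proof -
  have "0 < depth S x \<longleftrightarrow> (\<forall>v\<in>S. 0 < x v)"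
    using assms by (simp add: depth_pos_iff facet_finite facet_nonempty)
  also have "\<dots> \<longleftrightarrow> S \<subseteq> support x"
    using nonneg[OF assms(1)] by (auto simp: support_def less_le)
  also have "\<dots> \<longleftrightarrow> support x = S"
    using facet_maximal support_in assms by blast
  finally show ?thesis .
qed

lemma depth_facet_zero:
  "\<lbrakk>x \<in> topspace X; S \<in> \<S>; support x \<noteq> S\<rbrakk> \<Longrightarrow> depth S x = 0"
  using depth_facet_pos_iff depth_facet_nonneg by (metis less_eq_real_def)

text \<open>Here \<open>f S\<close> is any contribution that vanishes at depth 0. Together with the
  next lemma this evaluates the sums over all facets, which are continuous as they stand.\<close>

lemma sum_facets_zero:
  assumes "x \<in> topspace X" "support x \<notin> \<S>" "\<And>S. S \<in> \<S> \<Longrightarrow> f S 0 = (0::real)"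
  shows "(\<Sum>S\<in>\<S>. f S (depth S x)) = 0"
  using assms depth_facet_zero[OF assms(1)] by (intro sum.neutral) fastforce

lemma sum_facets_single:
  assumes "x \<in> topspace X" "support x = S" "S \<in> \<S>" "\<And>S. S \<in> \<S> \<Longrightarrow> f S 0 = (0::real)"
  shows "(\<Sum>S\<in>\<S>. f S (depth S x)) = f S (depth S x)"
proof -
  have "(\<Sum>T\<in>\<S> - {S}. f T (depth T x)) = 0"
    using assms depth_facet_zero[OF assms(1)] by (intro sum.neutral) fastforce
  then show ?thesis
    using assms(3) finite_facets by (subst sum.remove[of _ S]) auto
qed

section \<open>Extending the contraction of the cone\<close>

text \<open>The time left for moving towards the apex: all of \<open>t\<close> on the cone, where
  every depth is 0, and none once a depth reaches \<open>t / 2\<close>.\<close>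

definition cone_weight :: "real \<times> ('a \<Rightarrow> real) \<Rightarrow> real" where
  "cone_weight = (\<lambda>(t, x). max 0 (t - 2 * (\<Sum>S\<in>\<S>. depth S x)))"

text \<open>In an open facet this subtracts \<open>s\<close> times the barycentre, with
  \<open>s\<close> the smaller of the depth and \<open>t / 2\<close>, and rescales to sum 1. Halving
  \<open>t\<close> keeps the denominator at least 1/2 for \<open>t \<le> 1\<close>; with
  \<open>t\<close> in its place it would vanish at the barycentre at time 1.\<close>

definition shaved :: "real \<times> ('a \<Rightarrow> real) \<Rightarrow> 'a \<Rightarrow> real" where
  "shaved = (\<lambda>(t, x) v.
     (x v - (\<Sum>S\<in>\<S>. if v \<in> S then min (depth S x) (t / 2) / real (card S) else 0)) /
     (1 - (\<Sum>S\<in>\<S>. min (depth S x) (t / 2))))"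

text \<open>In a facet \<open>S\<close> write \<open>x = (1 - u) b + u c\<close> with \<open>c\<close> the barycentre, \<open>b\<close> in the boundary
  and \<open>u = depth S x\<close>. For \<open>u \<ge> t/2\<close> the point moves away from \<open>c\<close> along its ray, to the parameter
  \<open>(u - t/2) / (1 - t/2)\<close>; for \<open>u \<le> t/2\<close> it is first moved to \<open>b\<close> and then contracted in the cone
  for the time \<open>t - 2 u\<close>.\<close>

definition cone_contraction :: "real \<times> ('a \<Rightarrow> real) \<Rightarrow> 'a \<Rightarrow> real" where
  "cone_contraction z v =
     (1 - cone_weight z) * shaved z v + (if v = a then cone_weight z else 0)"

lemma cone_contraction_off_facets:
  assumes "x \<in> topspace X" "support x \<notin> \<S>" "0 \<le> t"
  shows "cone_weight (t, x) = t" and "shaved (t, x) = x"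
    and "cone_contraction (t, x) = (\<lambda>v. (1 - t) * x v + (if v = a then t else 0))"
proof -
  have "(\<Sum>S\<in>\<S>. depth S x) = 0"
    using sum_facets_zero[OF assms(1,2), of "\<lambda>S u. u"] by simp
  then show w: "cone_weight (t, x) = t"
    using assms(3) by (simp add: cone_weight_def)
  have "(\<Sum>S\<in>\<S>. min (depth S x) (t / 2)) = 0"
    using sum_facets_zero[OF assms(1,2), of "\<lambda>S u. min u (t / 2)"] assms(3) by simp
  moreover have "(\<Sum>S\<in>\<S>. if v \<in> S then min (depth S x) (t / 2) / real (card S) else 0) = 0" for v
    using sum_facets_zero[OF assms(1,2), of "\<lambda>S u. if v \<in> S then min u (t / 2) / real (card S) else 0"]
      assms(3) by simp
  ultimately show "shaved (t, x) = x"
    by (simp add: shaved_def)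
  then show "cone_contraction (t, x) = (\<lambda>v. (1 - t) * x v + (if v = a then t else 0))"
    using w by (simp add: cone_contraction_def fun_eq_iff)
qed

lemma cone_contraction_on_facet:
  assumes "x \<in> topspace X" "support x = S" "S \<in> \<S>" "0 \<le> t"
  shows "cone_weight (t, x) = max 0 (t - 2 * depth S x)"
    and "shaved (t, x) v = (x v - (if v \<in> S then min (depth S x) (t / 2) / real (card S) else 0)) /
           (1 - min (depth S x) (t / 2))"
    and "(\<Sum>S\<in>\<S>. min (depth S x) (t / 2)) = min (depth S x) (t / 2)"
proof -
  show "cone_weight (t, x) = max 0 (t - 2 * depth S x)"
    using sum_facets_single[OF assms(1-3), of "\<lambda>S u. u"] by (simp add: cone_weight_def)
  show 1: "(\<Sum>S\<in>\<S>. min (depth S x) (t / 2)) = min (depth S x) (t / 2)"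
    using sum_facets_single[OF assms(1-3), of "\<lambda>S u. min u (t / 2)"] assms(4) by simp
  have "(\<Sum>S\<in>\<S>. if v \<in> S then min (depth S x) (t / 2) / real (card S) else 0)
      = (if v \<in> S then min (depth S x) (t / 2) / real (card S) else 0)"
    using sum_facets_single[OF assms(1-3), of "\<lambda>S u. if v \<in> S then min u (t / 2) / real (card S) else 0"]
      assms(4) by simp
  then show "shaved (t, x) v = (x v - (if v \<in> S then min (depth S x) (t / 2) / real (card S) else 0)) /
           (1 - min (depth S x) (t / 2))"
    by (simp add: shaved_def 1)
qed

text \<open>The support stays inside the face \<open>insert a (support y)\<close>. By maximality a
  member of \<open>\<S>\<close> contained in that face would equal it, but members of
  \<open>\<S>\<close> avoid the apex.\<close>

lemma cone_join:
  assumes y: "y \<in> topspace X" "support y \<notin> \<S>" and \<alpha>: "0 \<le> \<alpha>" "\<alpha> \<le> 1"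
  defines "z \<equiv> \<lambda>v. (1 - \<alpha>) * y v + (if v = a then \<alpha> else 0)"
  shows "z \<in> topspace X" and "support z \<notin> \<S>"
proof -
  let ?F = "insert a (support y)"
  have F: "?F \<in> K"
    using y support_in cone by blast
  have fin: "finite ?F"
    using support_finite y by simp
  have "sum z ?F = (1 - \<alpha>) * sum y ?F + (\<Sum>v\<in>?F. if v = a then \<alpha> else 0)"
    by (simp only: z_def sum.distrib sum_distrib_left)
  also have "sum y ?F = 1"
    by (rule geometric_realization_sum[OF y(1) fin]) auto
  also have "(\<Sum>v\<in>?F. if v = a then \<alpha> else 0) = \<alpha>"
    using fin by (subst sum.delta) auto
  finally have "sum z ?F = 1" by simp
  then show z: "z \<in> topspace X"
    using \<alpha> nonneg[OF y(1)]
    by (intro geometric_realizationI[OF complex F]) (auto simp: z_def support_def)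
  have "support z \<subseteq> ?F"
    by (auto simp: z_def support_def split: if_splits)
  then show "support z \<notin> \<S>"
    using facet_maximal[OF _ F] apex_notin by blast
qed

text \<open>Each coordinate on \<open>S\<close> is at least \<open>depth S x / card S\<close>, so
  shaving keeps it nonnegative. A depth of at most \<open>t / 2\<close> is shaved off entirely: a
  smallest coordinate becomes 0 and the point drops to the boundary of \<open>S\<close>.\<close>

lemma shaved_in:
  assumes x: "x \<in> topspace X" "support x = S" "S \<in> \<S>" and t: "0 \<le> t" "t \<le> 1"
  shows "shaved (t, x) \<in> topspace X"
    and "2 * depth S x \<le> t \<Longrightarrow> support (shaved (t, x)) \<notin> \<S>"
proof -
  define s where "s = min (depth S x) (t / 2)"
  define y where "y = shaved (t, x)"
  have S: "finite S" "S \<noteq> {}" "S \<in> K"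
    using x facet_finite facet_nonempty facets_in by auto
  have y_eq: "y v = (x v - (if v \<in> S then s / real (card S) else 0)) / (1 - s)" for v
    using cone_contraction_on_facet(2)[OF x t(1)] by (simp add: y_def s_def)
  have s: "0 \<le> s" "s \<le> 1 / 2" "s \<le> depth S x"
    using depth_facet_nonneg[OF x(1,3)] t by (auto simp: s_def)
  have cS: "real (card S) > 0"
    using S by (simp add: card_gt_0_iff)
  have xS: "s / real (card S) \<le> x v" if "v \<in> S" for v
    using depth_le[OF S(1) that, of x] s(3) cS by (simp add: divide_le_eq mult.commute)
  have x0: "x v = 0" if "v \<notin> S" for v
    using that x(2) by (auto simp: support_def)
  have "(\<Sum>v\<in>S. x v - s / real (card S)) = 1 - s"
    using geometric_realization_sum[OF x(1) S(1)] x(2) cS by (simp add: sum_subtractf)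
  then have "sum y S = 1"
    using s by (simp add: y_eq flip: sum_divide_distrib)
  then show "shaved (t, x) \<in> topspace X"
    unfolding y_def[symmetric]
    using s xS x0 by (intro geometric_realizationI[OF complex S(3)]) (auto simp: y_eq)
  have sub: "support y \<subseteq> S"
    using x0 by (auto simp: y_eq support_def)
  show "support (shaved (t, x)) \<notin> \<S>" if le: "2 * depth S x \<le> t"
  proof
    assume "support (shaved (t, x)) \<in> \<S>"
    then have eq: "support y = S"
      using sub subset_facet x(3) by (auto simp: y_def)
    obtain v where v: "v \<in> S" "depth S x = real (card S) * x v"
      using depth_attained S by metis
    have "s = depth S x"
      using le by (simp add: s_def)
    then have "y v = 0"
      using v cS by (simp add: y_eq)
    then show False
      using eq v by (auto simp: support_def)
  qed
qed

lemma cone_contraction_in: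
  assumes x: "x \<in> topspace X" and t: "0 \<le> t" "t \<le> 1"
  shows "cone_contraction (t, x) \<in> topspace X"
proof (cases "support x \<in> \<S>")
  case False
  then show ?thesis
    using cone_join(1)[OF x False t] cone_contraction_off_facets(3)[OF x False t(1)] by simp
next
  case True
  note shaved = shaved_in[OF x refl True t]
  have w: "cone_weight (t, x) = max 0 (t - 2 * depth (support x) x)"
    by (rule cone_contraction_on_facet(1)[OF x refl True t(1)])
  show ?thesis
  \<comment> \<open>In the first case the shaved point lies in the cone and may be joined with the
    apex; in the second the weight is 0 and only the shaving acts.\<close>
  proof (cases "2 * depth (support x) x \<le> t")
    case True
    then have "0 \<le> cone_weight (t, x)" "cone_weight (t, x) \<le> 1"
      using w t depth_facet_nonneg[OF x \<open>support x \<in> \<S>\<close>] by auto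
    from cone_join(1)[OF shaved(1) shaved(2)[OF True] this] show ?thesis
      by (simp add: cone_contraction_def[abs_def])
  next
    case False
    then have "cone_contraction (t, x) = shaved (t, x)"
      using w by (simp add: cone_contraction_def fun_eq_iff)
    then show ?thesis using shaved(1) by simp
  qed
qed

text \<open>Apart from the cone, the fibres of the collapse are single points, so this is what makes
  the homotopy descend.\<close>

lemma cone_contraction_preserves_cone:
  assumes x: "x \<in> topspace X" "support x \<notin> \<S>" and t: "0 \<le> t" "t \<le> 1"
  shows "support (cone_contraction (t, x)) \<notin> \<S>"
  using cone_join(2)[OF x t] cone_contraction_off_facets(3)[OF x t(1)] by simp

lemma cone_contraction_0:
  assumes x: "x \<in> topspace X"
  shows "cone_contraction (0, x) = x"
proof (cases "support x \<in> \<S>")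
  case False
  then show ?thesis
    using cone_contraction_off_facets(3)[OF x False, of 0] by (simp add: fun_eq_iff)
next
  case True
  then show ?thesis
    using cone_contraction_on_facet[OF x refl True, of 0] depth_facet_nonneg[OF x True]
    by (simp add: cone_contraction_def fun_eq_iff)
qed

lemma cone_contraction_1:
  assumes x: "x \<in> topspace X" "support x \<notin> \<S>"
  shows "cone_contraction (1, x) = (\<lambda>v. if v = a then 1 else 0)"
  using cone_contraction_off_facets(3)[OF x, of 1] by (simp add: fun_eq_iff)

lemma continuous_map_cone_contraction:
  "continuous_map (prod_topology (top_of_set {0..1}) X) X cone_contraction"
proof (rule continuous_map_into_geometric_realization)
  let ?P = "prod_topology (top_of_set {0..1::real}) X"
  show "cone_contraction \<in> topspace ?P \<rightarrow> topspace X"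
    using cone_contraction_in by auto
  have "continuous_map ?P (top_of_set {0..1}) fst"
    by (rule continuous_map_fst)
  then have ct: "continuous_map ?P euclideanreal fst"
    by (rule continuous_map_into_fulltopology)
  have "continuous_map ?P euclideanreal ((\<lambda>x. x v) \<circ> snd)" for v
    by (rule continuous_map_compose[OF continuous_map_snd
          continuous_map_geometric_realization_coordinate])
  then have cx: "continuous_map ?P euclideanreal (\<lambda>z. snd z v)" for v
    by (simp add: o_def)
  have cd: "continuous_map ?P euclideanreal (\<lambda>z. depth S (snd z))" if "S \<in> \<S>" for S
    using that cx by (intro continuous_map_depth facet_finite facet_nonempty)
  \<comment> \<open>At most one summand is nonzero, and it is at most \<open>t / 2\<close>, hence at
    most 1/2.\<close>
  have nz: "1 - (\<Sum>S\<in>\<S>. min (depth S (snd z)) (fst z / 2)) \<noteq> 0" if z: "z \<in> topspace ?P" for z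
  proof -
    obtain t x where z: "z = (t, x)" "0 \<le> t" "t \<le> 1" "x \<in> topspace X"
      using z by auto
    show ?thesis
    proof (cases "support x \<in> \<S>")
      case True
      then show ?thesis
        using cone_contraction_on_facet(3)[OF z(4) refl True z(2)] z by simp
    next
      case False
      then show ?thesis
        using sum_facets_zero[OF z(4) False, of "\<lambda>S u. min u (t / 2)"] z by simp
    qed
  qed
  have cw: "continuous_map ?P euclideanreal cone_weight"
    unfolding cone_weight_def case_prod_unfold
    by (intro continuous_intros ct cd finite_facets) auto
  have csum: "continuous_map ?P euclideanreal
      (\<lambda>z. if v \<in> S then min (depth S (snd z)) (fst z / 2) / real (card S) else 0)"
    if "S \<in> \<S>" for v S
  proof (cases "v \<in> S")
    case True
    have "continuous_map ?P euclideanreal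
        (\<lambda>z. min (depth S (snd z)) (fst z / 2) / real (card S))"
      by (intro continuous_intros ct cd that) (use card_facet[OF that] in auto)
    then show ?thesis using True by simp
  qed simp
  have cs: "continuous_map ?P euclideanreal (\<lambda>z. shaved z v)" for v
    unfolding shaved_def case_prod_unfold
    by (intro continuous_intros ct cx cd csum finite_facets nz) auto
  show "continuous_map ?P euclideanreal (\<lambda>z. cone_contraction z v)" for v
    unfolding cone_contraction_def
    by (cases "v = a"; simp; intro continuous_intros cs cw)
qed

section \<open>Collapsing the cone\<close>

definition facet_to_sphere :: "'a set \<Rightarrow> ('a \<Rightarrow> real) \<Rightarrow> nat \<Rightarrow> real" where
  "facet_to_sphere S x = simplex_to_sphere (card S - 1) (to_standard S x)"

definition collapse :: "('a \<Rightarrow> real) \<Rightarrow> ('a set \<times> (nat \<Rightarrow> real)) option" where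
  "collapse x = (if support x \<in> \<S>
     then wedge_incl (\<lambda>_. sphere_base) (support x) (facet_to_sphere (support x) x) else None)"

lemma to_standard_in:
  assumes x: "x \<in> topspace X" "support x \<subseteq> S" and S: "S \<in> \<S>"
  shows "to_standard S x \<in> standard_simplex (card S - 1)"
proof -
  have "sum x S = 1"
    using geometric_realization_sum[OF x(1) facet_finite[OF S] x(2)] .
  moreover have "x v \<le> 1" for v
  proof -
    have "x v \<le> sum x (insert v S)"
      using nonneg[OF x(1)] facet_finite[OF S] by (intro member_le_sum) auto
    also have "\<dots> = 1"
      using x facet_finite[OF S] by (intro geometric_realization_sum[OF x(1)]) auto
    finally show ?thesis .
  qed
  ultimately show ?thesis
    using sum_to_standard[OF facet_finite[OF S] facet_nonempty[OF S], of x] nonneg[OF x(1)]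
    by (auto simp: standard_simplex_def to_standard_def)
qed

lemma facet_to_sphere_eq_base_iff:
  assumes "x \<in> topspace X" "support x \<subseteq> S" "S \<in> \<S>"
  shows "facet_to_sphere S x = sphere_base \<longleftrightarrow> support x \<noteq> S"
proof -
  have "facet_to_sphere S x = sphere_base \<longleftrightarrow> depth S x = 0"
    unfolding facet_to_sphere_def
    using simplex_to_sphere_eq_base_iff[OF to_standard_in[OF assms]]
      depth_to_standard facet_finite facet_nonempty assms(3) by metis
  then show ?thesis
    using depth_facet_pos_iff[OF assms(1,3)] depth_facet_zero[OF assms(1,3)] by auto
qed

text \<open>On the boundary of \<open>S\<close> the sphere map takes the base value, which
  \<open>wedge_incl\<close> sends to \<open>None\<close>. So the formula for the open facet persists
  on the closed one, where continuity can be checked.\<close>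

lemma collapse_on_facet:
  assumes x: "x \<in> topspace X" "support x \<subseteq> S" and S: "S \<in> \<S>"
  shows "collapse x = wedge_incl (\<lambda>_. sphere_base) S (facet_to_sphere S x)"
proof (cases "support x = S")
  case False
  then have "support x \<notin> \<S>"
    using subset_facet x S by blast
  then show ?thesis
    using facet_to_sphere_eq_base_iff[OF x S] False by (simp add: collapse_def wedge_incl_def)
qed (simp add: collapse_def S)

text \<open>A point in the interior of a facet is alone in its fibre: its image records the facet,
  and the stereographic map is injective away from the base point.\<close>

lemma collapse_eq:
  assumes x: "x \<in> topspace X" and y: "y \<in> topspace X" and eq: "collapse x = collapse y"
  shows "x = y \<or> support x \<notin> \<S> \<and> support y \<notin> \<S>"
proof -
  have some: "collapse z = Some (support z, facet_to_sphere (support z) z)"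
    if "z \<in> topspace X" "support z \<in> \<S>" for z
    using that facet_to_sphere_eq_base_iff[of z "support z"]
    by (simp add: collapse_def wedge_incl_def)
  have none: "collapse z = None" if "support z \<notin> \<S>" for z
    using that by (simp add: collapse_def)
  show ?thesis
  proof (cases "support x \<in> \<S>")
    case True
    then have "support y \<in> \<S>"
      using some[OF x] none eq by fastforce
    with True have S: "support y = support x"
      and f: "facet_to_sphere (support x) x = facet_to_sphere (support x) y"
      using eq some x y by auto
    let ?S = "support x"
    have fin: "finite ?S" "?S \<noteq> {}"
      using facet_finite facet_nonempty True by auto
    have "to_standard ?S x = to_standard ?S y"
    proof (rule simplex_to_sphere_inj)
      show "to_standard ?S x \<in> standard_simplex (card ?S - 1)"
        by (rule to_standard_in[OF x order_refl True])
      show "to_standard ?S y \<in> standard_simplex (card ?S - 1)"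
        by (rule to_standard_in[OF y _ True]) (simp add: S)
      show "simplex_to_sphere (card ?S - 1) (to_standard ?S x)
          = simplex_to_sphere (card ?S - 1) (to_standard ?S y)"
        using f by (simp add: facet_to_sphere_def)
      show "simplex_to_sphere (card ?S - 1) (to_standard ?S x) \<noteq> sphere_base"
        using facet_to_sphere_eq_base_iff[OF x order_refl True] by (simp add: facet_to_sphere_def)
    qed
    then have "x v = y v" if "v \<in> ?S" for v
      using that by (rule to_standard_eq_imp_eq_on[OF fin])
    moreover have "x v = y v" if "v \<notin> ?S" for v
    proof -
      have "v \<notin> support y" using that S by simp
      then show ?thesis using that by (simp add: support_def)
    qed
    ultimately show ?thesis by blast
  next
    case False
    then have "support y \<notin> \<S>"
      using some[OF y] none eq by fastforce
    with False show ?thesis by blast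
  qed
qed

abbreviation "B \<equiv> bouquet \<S> (\<lambda>S. card S - 1)"

lemma continuous_map_facet_to_sphere:
  assumes S: "S \<in> \<S>"
  shows "continuous_map (subtopology X {x. support x \<subseteq> S}) (nsphere (card S - 1)) (facet_to_sphere S)"
proof -
  let ?T = "subtopology X {x. support x \<subseteq> S}"
  have "continuous_map ?T euclideanreal (\<lambda>x. to_standard S x i)" for i
    unfolding to_standard_def
    by (cases "i \<le> card S - 1")
       (auto intro: continuous_map_from_subtopology continuous_map_geometric_realization_coordinate)
  then have "continuous_map ?T (subtopology (powertop_real UNIV) (standard_simplex (card S - 1)))
      (to_standard S)"
    using to_standard_in[OF _ _ S]
    by (auto simp: continuous_map_in_subtopology continuous_map_componentwise_UNIV)
  then have "continuous_map ?T (nsphere (card S - 1)) (simplex_to_sphere (card S - 1) \<circ> to_standard S)"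
    using continuous_map_simplex_to_sphere by (rule continuous_map_compose)
  then show ?thesis
    by (simp add: facet_to_sphere_def[abs_def] o_def)
qed

lemma closedin_facet:
  "closedin X {x \<in> topspace X. support x \<subseteq> S}"
proof -
  have "{x \<in> topspace X. support x \<subseteq> S} =
      topspace X \<inter> (\<Inter>v\<in>-S. {x \<in> topspace X. x v \<in> {0}})"
    by (auto simp: support_def)
  also have "closedin X \<dots>"
  \<comment> \<open>For \<open>S = UNIV\<close> the family is empty and its intersection is the
    whole type, so \<open>closedin_Inter\<close> does not apply.\<close>
  proof (cases "S = UNIV")
    case False
    have "closedin X {x \<in> topspace X. x v \<in> {0}}" for v
      by (rule closedin_continuous_map_preimage[OF continuous_map_geometric_realization_coordinate])
         simp
    then have "closedin X (\<Inter>v\<in>-S. {x \<in> topspace X. x v \<in> {0}})"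
      using False by (intro closedin_Inter) blast+
    then show ?thesis by (intro closedin_Int) auto
  qed simp
  finally show ?thesis .
qed

lemma continuous_map_collapse: "continuous_map X B collapse"
proof (rule pasting_lemma_closed)
  \<comment> \<open>A finite closed cover by the cone, with index \<open>None\<close>, and the
    closed facets; the cone is the zero set of the total depth. The functions \<open>?f i\<close> do
    not depend on \<open>i\<close>, so they agree on overlaps.\<close>
  let ?I = "insert None (Some ` \<S>)"
  let ?T = "\<lambda>i. case i of None \<Rightarrow> {x \<in> topspace X. (\<Sum>S\<in>\<S>. depth S x) \<in> {0}}
                       | Some S \<Rightarrow> {x \<in> topspace X. support x \<subseteq> S}"
  let ?f = "\<lambda>i x. if x \<in> topspace X then collapse x else None"
  show "finite ?I" using finite_facets by simp
  have off: "support x \<notin> \<S>" if "x \<in> topspace X" "(\<Sum>S\<in>\<S>. depth S x) = 0" for x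
  proof
    assume S: "support x \<in> \<S>"
    then have "(\<Sum>S\<in>\<S>. depth S x) = depth (support x) x"
      using sum_facets_single[OF that(1) refl, of "\<lambda>S u. u"] by simp
    then show False
      using depth_facet_pos_iff[OF that(1) S] that(2) by simp
  qed
  show "closedin X (?T i)" if "i \<in> ?I" for i
  proof (cases i)
    case None
    have "continuous_map X euclideanreal (\<lambda>x. \<Sum>S\<in>\<S>. depth S x)"
      by (intro continuous_intros continuous_map_depth finite_facets facet_finite facet_nonempty
          continuous_map_geometric_realization_coordinate)
    then have "closedin X {x \<in> topspace X. (\<Sum>S\<in>\<S>. depth S x) \<in> {0}}"
      by (rule closedin_continuous_map_preimage) simp
    then show ?thesis using None by simp
  qed (simp add: closedin_facet)
  show "continuous_map (subtopology X (?T i)) B (?f i)" if "i \<in> ?I" for i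
  proof (cases i)
    case None
    have "continuous_map (subtopology X (?T i)) B (\<lambda>_. None)"
      by (simp add: bouquet_def topspace_wedge wedge_carrier_def)
    then show ?thesis
      by (rule continuous_map_eq) (use None off in \<open>auto simp: collapse_def\<close>)
  next
    case (Some S)
    with that have S: "S \<in> \<S>" by auto
    have sub: "subtopology X (?T i) = subtopology X {x. support x \<subseteq> S}"
      using Some subtopology_restrict[of X "{x. support x \<subseteq> S}"] by (simp add: Int_def)
    have "continuous_map (nsphere (card S - 1)) B (wedge_incl (\<lambda>_. sphere_base) S)"
      using continuous_map_wedge_incl[OF S, of "\<lambda>S. nsphere (card S - 1)"] by (simp add: bouquet_def)
    with continuous_map_facet_to_sphere[OF S]
    have "continuous_map (subtopology X {x. support x \<subseteq> S}) B
        (wedge_incl (\<lambda>_. sphere_base) S \<circ> facet_to_sphere S)"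
      by (rule continuous_map_compose)
    then show ?thesis
      unfolding sub
      by (rule continuous_map_eq) (use collapse_on_facet[OF _ _ S] in auto)
  qed
  show "\<exists>j. j \<in> ?I \<and> x \<in> ?T j \<and> collapse x = ?f j x" if x: "x \<in> topspace X" for x
  proof (cases "support x \<in> \<S>")
    case True
    then show ?thesis using x by (intro exI[of _ "Some (support x)"]) auto
  next
    case False
    then have "(\<Sum>S\<in>\<S>. depth S x) = 0"
      using sum_facets_zero[OF x False, of "\<lambda>S u. u"] by simp
    then show ?thesis using x by (intro exI[of _ None]) auto
  qed
qed auto

lemma from_standard_in:
  assumes S: "S \<in> \<S>" and t: "t \<in> standard_simplex (card S - 1)"
  shows "from_standard S t \<in> topspace X"
proof (rule geometric_realizationI[OF complex])
  show "S \<in> K" using S facets_in by blast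
  have "sum (from_standard S t) S = sum (to_standard S (from_standard S t)) {..card S - 1}"
    using sum_to_standard facet_finite facet_nonempty S by metis
  also have "\<dots> = sum t {..card S - 1}"
    using to_standard_from_standard facet_finite facet_nonempty S t by metis
  also have "\<dots> = 1"
    using t by (simp add: standard_simplex_def)
  finally show "sum (from_standard S t) S = 1" .
qed (use t in \<open>auto simp: from_standard_def standard_simplex_def\<close>)

lemma collapse_from_standard:
  assumes S: "S \<in> \<S>" and t: "t \<in> standard_simplex (card S - 1)"
  shows "collapse (from_standard S t) =
    wedge_incl (\<lambda>_. sphere_base) S (simplex_to_sphere (card S - 1) t)"
proof -
  have "support (from_standard S t) \<subseteq> S"
    by (auto simp: support_def from_standard_def)
  then show ?thesis
    using collapse_on_facet[OF from_standard_in[OF S t] _ S]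
      to_standard_from_standard[OF facet_finite[OF S] facet_nonempty[OF S] t]
    by (simp add: facet_to_sphere_def)
qed

text \<open>The wedge has the final topology, so openness is tested sphere by sphere. There
  \<open>simplex_to_sphere\<close> is a quotient map, and the preimage in the standard simplex is
  also the preimage under \<open>from_standard S\<close> of an open set of the realization.\<close>

lemma quotient_map_collapse: "quotient_map X B collapse"
  unfolding quotient_map_def
proof (intro conjI allI impI iffI)
  have dim: "0 < card S - 1" if "S \<in> \<S>" for S
    using card_facet[OF that] by simp
  show "collapse ` topspace X = topspace B"
  proof
    show "collapse ` topspace X \<subseteq> topspace B"
      using continuous_map_collapse by (rule continuous_map_image_subset_topspace)
    show "topspace B \<subseteq> collapse ` topspace X"
    proof
      fix z assume "z \<in> topspace B"
      then consider "z = None"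
        | S y where "S \<in> \<S>" "y \<in> topspace (nsphere (card S - 1))" "z = wedge_incl (\<lambda>_. sphere_base) S y"
        by (auto simp: bouquet_def topspace_wedge wedge_carrier_def)
      then show "z \<in> collapse ` topspace X"
      proof cases
        case 1
        \<comment> \<open>The apex is a preimage of \<open>None\<close> even when
          \<open>\<S>\<close> is empty.\<close>
        let ?e = "\<lambda>v. if v = a then 1 else 0 :: real"
        have "support ?e = {a}"
          by (auto simp: support_def)
        then have "collapse ?e = None"
          using apex_notin by (auto simp: collapse_def)
        then show ?thesis using 1 apex_in by (metis imageI)
      next
        case 2
        then obtain t where "t \<in> standard_simplex (card S - 1)" "y = simplex_to_sphere (card S - 1) t"
          using simplex_to_sphere_surj[OF dim[OF 2(1)]] by blast
        then show ?thesis
          using 2 from_standard_in collapse_from_standard by (metis imageI)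
      qed
    qed
  qed
  fix U assume U: "U \<subseteq> topspace B"
  show "openin X {x \<in> topspace X. collapse x \<in> U}" if "openin B U"
    using continuous_map_collapse that by (simp add: continuous_map_def)
  assume op: "openin X {x \<in> topspace X. collapse x \<in> U}"
  show "openin B U"
    unfolding bouquet_def openin_wedge
  proof (intro conjI ballI)
    show "U \<subseteq> wedge_carrier \<S> (\<lambda>S. nsphere (card S - 1)) (\<lambda>_. sphere_base)"
      using U by (simp add: bouquet_def topspace_wedge)
    fix S assume S: "S \<in> \<S>"
    let ?d = "card S - 1"
    let ?D = "subtopology (powertop_real UNIV) (standard_simplex ?d)"
    let ?V = "{y \<in> topspace (nsphere ?d). wedge_incl (\<lambda>_. sphere_base) S y \<in> U}"
    have "continuous_map ?D euclideanreal (\<lambda>t. from_standard S t v)" for v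
      unfolding from_standard_def
      by (cases "v \<in> S") (auto intro: continuous_map_from_subtopology continuous_map_product_projection)
    then have "continuous_map ?D X (from_standard S)"
      by (intro continuous_map_into_geometric_realization) (auto intro: from_standard_in[OF S])
    then have "openin ?D {t \<in> topspace ?D. from_standard S t \<in> {x \<in> topspace X. collapse x \<in> U}}"
      using op by (rule openin_continuous_map_preimage)
    also have "{t \<in> topspace ?D. from_standard S t \<in> {x \<in> topspace X. collapse x \<in> U}}
        = {t \<in> topspace ?D. simplex_to_sphere ?d t \<in> ?V}"
      using from_standard_in[OF S] collapse_from_standard[OF S] simplex_to_sphere_in_nsphere by auto
    finally have "openin ?D {t \<in> topspace ?D. simplex_to_sphere ?d t \<in> ?V}" .
    moreover have "?V \<subseteq> topspace (nsphere ?d)"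
      by (rule Collect_restrict)
    ultimately show "openin (nsphere ?d) ?V"
      using quotient_map_simplex_to_sphere[OF dim[OF S]] by (simp only: quotient_map_def)
  qed
qed

theorem realization_homotopy_equivalent_bouquet: "X homotopy_equivalent_space B"
proof (rule homotopy_equivalent_space_quotient)
  show "quotient_map X B collapse"
    by (rule quotient_map_collapse)
  show "continuous_map (prod_topology (top_of_set {0..1}) X) X cone_contraction"
    by (rule continuous_map_cone_contraction)
  show "cone_contraction (0, x) = x" if "x \<in> topspace X" for x
    using that by (rule cone_contraction_0)
  fix x y assume x: "x \<in> topspace X" and y: "y \<in> topspace X" and "collapse x = collapse y"
  then have eq: "x = y \<or> support x \<notin> \<S> \<and> support y \<notin> \<S>"
    by (rule collapse_eq)
  show "collapse (cone_contraction (t, x)) = collapse (cone_contraction (t, y))"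
    if "t \<in> {0..1}" for t
    using eq cone_contraction_preserves_cone x y that by (auto simp: collapse_def)
  show "cone_contraction (1, x) = cone_contraction (1, y)"
    using eq cone_contraction_1 x y by auto
qed

end

section \<open>The divisor complex\<close>

lemma one_proper_divisor: "2 \<le> n \<Longrightarrow> 1 \<in> proper_divisors n"
  by (auto simp: proper_divisors_def)

text \<open>Divisors are positive, so a proper superset has a larger sum. This yields the maximality
  of sphere collections among the faces, and their uniqueness for perfect \<open>n\<close>.\<close>

lemma sum_proper_divisors_subset_eq:
  assumes "S \<subseteq> T" "T \<subseteq> proper_divisors n" "0 < n" "\<Sum>T \<le> \<Sum>S"
  shows "T = S"
proof (rule ccontr)
  assume "T \<noteq> S"
  then obtain v where v: "v \<in> T" "v \<notin> S" using assms(1) by blast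
  have fin: "finite T"
    using assms finite_proper_divisors finite_subset by blast
  then have "\<Sum>(insert v S) \<le> \<Sum>T"
    using v assms(1) by (intro sum_mono2) auto
  moreover have "0 < v"
    using v assms(2) by (auto simp: proper_divisors_def)
  ultimately show False
    using v assms(1,4) finite_subset[OF assms(1) fin] by simp
qed

lemma perfect_iff_sphere_collection:
  assumes "2 \<le> n"
  shows "perfect n \<longleftrightarrow> proper_divisors n - {1} \<in> sphere_collections n"
proof -
  have "\<Sum>(proper_divisors n) = 1 + \<Sum>(proper_divisors n - {1})"
    using sum.remove[OF finite_proper_divisors one_proper_divisor, of n "\<lambda>x. x"] assms by simp
  then show ?thesis
    using assms by (auto simp: perfect_def sphere_collections_def)
qed

text \<open>The two divisors left out are 1 and \<open>n\<close>. Hence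
  \<open>divisor_count n - 3\<close> is the dimension of the simplex on all proper divisors except
  1.\<close>

lemma card_proper_divisors_minus_one:
  assumes "2 \<le> n"
  shows "divisor_count n = card (proper_divisors n - {1}) + 2"
proof -
  have fin: "finite (proper_divisors n)"
    using assms finite_proper_divisors by simp
  have "{d. 0 < d \<and> d dvd n} = insert n (proper_divisors n)"
    using assms by (auto simp: proper_divisors_def)
  moreover have "n \<notin> proper_divisors n"
    by (simp add: proper_divisors_def)
  ultimately have "divisor_count n = Suc (card (proper_divisors n))"
    using fin by (simp add: divisor_count_def)
  also have "card (proper_divisors n) = Suc (card (proper_divisors n - {1}))"
    using card.remove[OF fin one_proper_divisor[OF assms]] .
  finally show ?thesis by simp
qed

lemma cone_with_facets_Div_complex:
  assumes n: "2 \<le> n"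
  shows "cone_with_facets (Div_complex n) 1 (sphere_collections n)"
proof
  have fin: "finite (proper_divisors n)"
    using n finite_proper_divisors by simp
  have "simplicial_complex_on (proper_divisors n) (Div_complex n)"
    by (rule simplicial_complex_Div_complex) (use n in simp)
  then show "simplicial_complex_on UNIV (Div_complex n)"
    unfolding simplicial_complex_on_def by blast
  show "{1} \<in> Div_complex n"
    using n one_proper_divisor by (simp add: Div_complex_def)
  show "finite (sphere_collections n)"
    by (rule finite_subset[of _ "Pow (proper_divisors n)"])
       (auto simp: sphere_collections_def fin)
  show sub: "sphere_collections n \<subseteq> Div_complex n"
  proof
    fix S assume S: "S \<in> sphere_collections n"
    then show "S \<in> Div_complex n"
      using n sphere_collections_finite_nonempty(2)[OF n S]
      by (auto simp: sphere_collections_def Div_complex_def)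
  qed
  show "F = S" if "S \<in> sphere_collections n" "F \<in> Div_complex n" "S \<subseteq> F" for S F
  proof (rule sum_proper_divisors_subset_eq)
    show "F \<subseteq> proper_divisors n"
      using that by (simp add: Div_complex_def)
    have "\<Sum>S = n - 1" "\<Sum>F < n"
      using that by (simp_all add: sphere_collections_def Div_complex_def)
    then show "\<Sum>F \<le> \<Sum>S" "0 < n"
      by linarith+
  qed (use that in blast)
  show "1 \<notin> S" if "S \<in> sphere_collections n" for S
    using that by (auto simp: sphere_collections_def)
  \<comment> \<open>A singleton would be \<open>{n - 1}\<close>, but \<open>n - 1\<close> divides
    \<open>n\<close> only if it is 1, which collections exclude. So no 0-spheres occur.\<close>
  show "2 \<le> card S" if S: "S \<in> sphere_collections n" for S
  proof (rule ccontr)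
    assume "\<not> 2 \<le> card S"
    moreover have "card S \<noteq> 0"
      using sphere_collections_finite_nonempty[OF n S] by simp
    ultimately have "card S = 1" by linarith
    then obtain v where "S = {v}"
      by (auto simp: card_1_singleton_iff)
    with S have v: "v = n - 1" "v dvd n" "v \<noteq> 1"
      by (auto simp: sphere_collections_def proper_divisors_def)
    then have "v dvd n - v"
      by (simp add: dvd_diff_nat)
    then show False using v n by simp
  qed
  show "insert 1 F \<in> Div_complex n" if F: "F \<in> Div_complex n" "F \<notin> sphere_collections n" for F
  proof (cases "1 \<in> F")
    case True
    then show ?thesis using F by (simp add: insert_absorb)
  next
    case False
    have sub: "F \<subseteq> proper_divisors n" and "\<Sum>F < n"
      using F(1) by (simp_all add: Div_complex_def)
    have "\<Sum>F \<noteq> n - 1"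
      using F(2) sub False by (simp add: sphere_collections_def subset_Diff_insert)
    moreover have "\<Sum>(insert 1 F) = 1 + \<Sum>F"
      using False finite_subset[OF sub fin] by (rule sum.insert[rotated])
    ultimately have "\<Sum>(insert 1 F) < n"
      using \<open>\<Sum>F < n\<close> by linarith
    then show ?thesis
      using sub one_proper_divisor[OF n] by (simp add: Div_complex_def)
  qed
qed

text \<open>Even all proper divisors other than 1 together sum to less than
  \<open>n - 1\<close>.\<close>

lemma deficient_sphere_collections:
  assumes "deficient n"
  shows "sphere_collections n = {}"
proof (rule ccontr)
  assume "sphere_collections n \<noteq> {}"
  then obtain S where S: "S \<subseteq> proper_divisors n - {1}" "\<Sum>S = n - 1"
    by (auto simp: sphere_collections_def)
  have n: "2 \<le> n" "\<Sum>(proper_divisors n) < n"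
    using assms by (auto simp: deficient_def)
  have fin: "finite (proper_divisors n)"
    using n finite_proper_divisors by simp
  have "\<Sum>S \<le> \<Sum>(proper_divisors n - {1})"
    using S(1) fin by (intro sum_mono2) auto
  also have "\<Sum>(proper_divisors n) = 1 + \<Sum>(proper_divisors n - {1})"
    by (rule sum.remove[OF fin one_proper_divisor[OF n(1)]])
  then have "\<Sum>(proper_divisors n - {1}) < n - 1"
    using n by linarith
  finally show False using S(2) by simp
qed

text \<open>Only the empty space maps to the empty space. This settles prime \<open>n\<close>, for
  which the sphere in (2) has dimension -1.\<close>

lemma homotopy_equivalent_trivial_topology:
  "X homotopy_equivalent_space trivial_topology \<Longrightarrow> X = trivial_topology"
  by (auto simp: homotopy_equivalent_space_def continuous_map_def simp flip: null_topspace_iff_trivial)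

theorem theorem1p7:
  fixes n :: nat
  assumes "2 \<le> n"
  shows "geometric_realization (Div_complex n) homotopy_equivalent_space
           bouquet (sphere_collections n) (\<lambda>S. card S - 1)
       \<and> (deficient n \<longrightarrow> contractible_space (geometric_realization (Div_complex n)))
       \<and> (perfect n \<longleftrightarrow>
           geometric_realization (Div_complex n) homotopy_equivalent_space
             sphere_space (int (divisor_count n) - 3))"
proof (intro conjI impI iffI)
  let ?X = "geometric_realization (Div_complex n)"
  let ?\<S> = "sphere_collections n"
  let ?B = "bouquet ?\<S> (\<lambda>S. card S - 1)"
  let ?P = "proper_divisors n - {1}"
  interpret cone_with_facets "Div_complex n" 1 ?\<S>
    by (rule cone_with_facets_Div_complex[OF assms])
  show XB: "?X homotopy_equivalent_space ?B"
    by (rule realization_homotopy_equivalent_bouquet)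
  have contr: "contractible_space ?X" if "?\<S> = {}"
    using homotopy_equivalent_space_contractibility[OF XB] that
    by (simp add: bouquet_def contractible_space_wedge_empty)
  show "contractible_space ?X" if "deficient n"
    using contr deficient_sphere_collections[OF that] by blast
  show "?X homotopy_equivalent_space sphere_space (int (divisor_count n) - 3)" if "perfect n"
  proof -
    have P: "?P \<in> ?\<S>"
      using perfect_iff_sphere_collection[OF assms] that by blast
    \<comment> \<open>Every collection is contained in \<open>?P\<close> and has the same
      sum.\<close>
    have "S = ?P" if "S \<in> ?\<S>" for S
      using that P assms sum_proper_divisors_subset_eq[of S ?P n]
      by (auto simp: sphere_collections_def)
    with P have "?\<S> = {?P}" by blast
    then have "?B homeomorphic_space nsphere (card ?P - 1)"
      using homeomorphic_space_wedge_singleton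
        [of "\<lambda>_. sphere_base" ?P "\<lambda>S. nsphere (card S - 1)"]
      by (simp add: bouquet_def sphere_base_in_nsphere)
    then have "?X homotopy_equivalent_space nsphere (card ?P - 1)"
      using XB homotopy_eqv_trans homeomorphic_imp_homotopy_equivalent_space by blast
    moreover have "sphere_space (int (divisor_count n) - 3) = nsphere (card ?P - 1)"
      using card_proper_divisors_minus_one[OF assms] card_facet[OF P]
      by (simp add: sphere_space_def nat_diff_distrib')
    ultimately show ?thesis by simp
  qed
  show "perfect n" if eq: "?X homotopy_equivalent_space sphere_space (int (divisor_count n) - 3)"
  proof -
    have "?X \<noteq> trivial_topology"
      using apex_in by force
    then have "\<not> int (divisor_count n) - 3 < 0"
      using eq by (auto simp: sphere_space_def dest: homotopy_equivalent_trivial_topology)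
    then have pos: "0 < card ?P" and
      X: "?X homotopy_equivalent_space nsphere (card ?P - 1)"
      using eq card_proper_divisors_minus_one[OF assms]
      by (auto simp: sphere_space_def nat_diff_distrib')
    then have B: "?B homotopy_equivalent_space nsphere (card ?P - 1)"
      using XB homotopy_eqv_trans homotopy_equivalent_space_sym by blast
    \<comment> \<open>Without spheres the realization would be contractible, but
      \<open>nsphere\<close> is not.\<close>
    have "?\<S> \<noteq> {}"
      using contr homotopy_equivalent_space_contractibility[OF X] non_contractible_space_nsphere
      by blast
    then obtain S where S: "S \<in> ?\<S>" by blast
    \<comment> \<open>Both cardinals are positive, so the truncated subtraction of 1 in the two
      dimensions cancels.\<close>
    have "card S = card ?P"
      using bouquet_sphere_dimension[OF S B] pos card_facet[OF S] by simp
    moreover have "S \<subseteq> ?P" "finite ?P"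
      using S assms finite_proper_divisors by (auto simp: sphere_collections_def)
    ultimately have "S = ?P"
      using card_subset_eq by blast
    then show ?thesis
      using S perfect_iff_sphere_collection[OF assms] by blast
  qed
qed

end
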